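(* Consider a sequence of problems indexed by $n\to\infty$ in which $p=p_n\to\infty$ with $p\in O(\exp(n^a))$ and $|S^*|\in O(n^b)$ for some $a>0$, $b\ge0$; the function $G$ and the constants $K>0$, $D>0$, $L\ge8$ do not depend on $n$. Assume for every $n$ that $\rho_f(x,y)=\gamma(y,f(x))+c(f)$, where $c(f)$ is a constant possibly depending on $f$; that $|\gamma(y,f_\beta(x))-\gamma(y,f_{\tilde\beta}(x))|\le D|f_\beta(x)-f_{\tilde\beta}(x)|$ for all $(x,y)\in\mathcal X\times\mathcal Y$ and $\beta,\tilde\beta\in\Phi$; that $\frac1n\sum_{i=1}^n\max_{1\le j\le p}E\psi_j^2(X_i)\le1$ and $\max_{1\le j\le p}\|\psi_j\|_\infty\le K$; and that $p\ge2$ and $\log(p)\le n$. Then, with the choice $\lambda_0=dD\sqrt{\log(p)/n}$ for some positive constant $d$, the following holds. Suppose that $8\lambda_0\le\lambda_1\le L\lambda_0$, that $\lambda_2=\lambda_1\sqrt{s^*}/(2\|\beta^*\|_2)$, and that (1) the margin condition holds with strictly convex $G$, i.e. $\Xi(f)\ge G(\|f-f^0\|)$ for all $f\in\mathbf F_{\text{local}}$; (2) $f^*\in\mathbf F_{\text{local}}$, and $f_\beta\in\mathbf F_{\text{local}}$ for all $\beta$ with $\|\beta-\beta^*\|_1\le M^*$; (3) $\phi_*=\phi(S^* )>0$. If $a+b<1$ and $\phi_*$ is bounded away from zero (uniformly in $n$), then $$\limsup_{n\to\infty}\Xi(\hat f)\le6\limsup_{n\to\infty}\Xi(f^* )$$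 with probability approaching one, i.e. for every $\varepsilon>0$, $P\big(\Xi(\hat f)\le6\limsup_{m\to\infty}\Xi(f^*_{(m)})+\varepsilon\big)\to1$ as $n\to\infty$, where $f^*_{(m)}$ denotes the oracle function $f^*$ in the $m$-th problem.
   Context: Setting (for each $n$; objects may depend on $n$ unless said otherwise). $Z_i=(X_i,Y_i)$, $i=1,\dots,n$, is an independent sample on a probability space $(\Omega,\mathcal F,P)$ with values in $\mathcal Z=\mathcal X\times\mathcal Y$, $\mathcal Y\subseteq\mathbb R$. $\mathbf F$ is a normed real vector space, with norm $\|\cdot\|$, of functions $f:\mathcal X\to\mathbb R$. For each $f\in\mathbf F$, $\rho_f:\mathcal Z\to\mathbb R$ is a loss function, and $f\mapsto\rho_f(z)$ is convex for every $z\in\mathcal Z$. Put $P_n\rho_f=\frac1n\sum_{i=1}^n\rho_f(Z_i)$ and $P\rho_f=\frac1n\sum_{i=1}^nE\rho_f(Z_i)$. The target is $f^0=\arg\min_{f\in\mathbf F}P\rho_f$, assumed to exist and be unique, and the excess risk is $\Xi(f)=P(\rho_f-\rho_{f^0})\ge0$. Given $\psi_1,\dots,\psi_p\in\mathbf F$, let $f_\beta=\sum_{j=1}^p\beta_j\psi_j$ for $\beta\in\mathbb R^p$. Let $\Phi\subseteq\mathbb R^p$ be convex. For $\lambda_1,\lambda_2>0$ the elastic net estimator is $\hat f=f_{\hat\beta}$, where $\hat\beta$ minimizes $P_n\rho_{f_\beta}+\lambda_1\|\beta\|_1+\lambda_2\|\beta\|_2^2$ over $\beta\in\Phi$. $\|f\|_\infty=\sup_{x\in\mathcal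 X}|f(x)|$, and $\mathbf F_{\text{local}}=\{f\in\mathbf F:\|f-f^0\|_\infty\le\eta\}$ for a given $\eta>0$. $G$ is a strictly convex function on $[0,\infty)$ with $G(0)=0$, and its convex conjugate is $H(v)=\sup_{u\ge0}\{uv-G(u)\}$, $v\ge0$. For $S\subseteq\{1,\dots,p\}$, $\beta_S$ denotes the vector with entries $\beta_j1_{\{j\in S\}}$, and $S^c$ is the complement of $S$. For $b\in\mathbb R^p$ let $S_b=\{j:b_j\ne0\}$, $s_b=|S_b|$. The adaptive restricted eigenvalue attached to $b$ and $S=S_b$ is given by $$\phi^2(S)=\min\Big\{\frac{\|f_\beta\|^2}{\|\beta_S\|_2^2}:\beta\in\mathbb R^p\setminus\{0\},\ \|\beta_{S^c}\|_1\le L_n\|\beta_S\|_2\Big\},\qquad L_n=3\Big(\sqrt{|S|}+\frac{2\lambda_2\|b_S\|_2}{\lambda_1}\Big),$$ with the vector $b$ fixed in the minimization. Given a collection $\Gamma$ of subsets of $\{1,\dots,p\}$, the oracle is $$\beta^*=\arg\min_{\beta\in\mathbb R^p:\,S_\beta\in\Gamma}\Big\{3\,\Xi(f_\beta)+2H\Big(\frac{4\lambda_1\sqrt{s_\beta}+4\lambda_2\|\beta\|_2}{\phi(S_\beta)}\Big)\Big\}.$$ Put $S^*=S_{\beta^*}$, $s^*=|S^*|$, $\phi_*=\phi(S^* )$ (with $L_n$ computed from the vector $\beta^*$), $f^*=f_{\beta^*}$, and $$2\Delta^*=3\,\Xi(f^* )+2H\Big(\frac{4\lambda_1\sqrt{s^*}+4\lambda_2\|\beta^*\|_2}{\phi_*}\Big),\qquad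 M^*=\Delta^*/\lambda_0.$$
   Formalization: The formal theorem additionally assumes that the oracle β* lies in Φ, the set over which the estimator minimizes; without this the claim is false (e.g. Φ={0} with squared loss and target Rψ_1, where the estimator is 0 while Ξ(f* )→0). *)

theory Defs
  imports "HOL-Probability.Probability"
begin

definition strictly_convex_on :: "real set \<Rightarrow> (real \<Rightarrow> real) \<Rightarrow> bool" where
  "strictly_convex_on I G \<longleftrightarrow> convex I \<and>
     (\<forall>x\<in>I. \<forall>y\<in>I. \<forall>t. x \<noteq> y \<longrightarrow> 0 < t \<longrightarrow> t < 1 \<longrightarrow>
        G (t * x + (1 - t) * y) < t * G x + (1 - t) * G y)"

(* The conjugate can be infinite when G grows at most linearly, so it takes values in ereal.
   At the argument \<infinity> the formula gives \<infinity>, because 0 * \<infinity> = 0 and u * \<infinity> = \<infinity> for u > 0. *)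
definition conv_conj :: "(real \<Rightarrow> real) \<Rightarrow> ereal \<Rightarrow> ereal" where
  "conv_conj G v = (SUP u\<in>{0..}. ereal u * v - ereal (G u))"

(* Events defined through an estimator need not be measurable.  On measurable sets
   inner_prob is the measure itself, see inner_prob_eq_measure. *)
definition inner_prob :: "'w measure \<Rightarrow> 'w set \<Rightarrow> real" where
  "inner_prob M A = Sup {measure M B | B. B \<in> sets M \<and> B \<subseteq> A}"

lemma inner_prob_eq_measure:
  assumes "prob_space M" "A \<in> sets M"
  shows "inner_prob M A = measure M A"
proof -
  interpret prob_space M by fact
  show ?thesis
    unfolding inner_prob_def
    by (rule cSup_eq_maximum) (use assms(2) in \<open>auto intro!: finite_measure_mono\<close>)
qed

(* A vector in R^p is a function on nat that vanishes outside {1..p}. *)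
definition Rvec :: "nat \<Rightarrow> (nat \<Rightarrow> real) set" where
  "Rvec p = {\<beta>. \<forall>j. j \<notin> {1..p} \<longrightarrow> \<beta> j = 0}"

definition l1norm :: "nat \<Rightarrow> (nat \<Rightarrow> real) \<Rightarrow> real" where
  "l1norm p \<beta> = (\<Sum>j=1..p. \<bar>\<beta> j\<bar>)"

definition l2norm :: "nat \<Rightarrow> (nat \<Rightarrow> real) \<Rightarrow> real" where
  "l2norm p \<beta> = L2_set \<beta> {1..p}"

definition restr :: "(nat \<Rightarrow> real) \<Rightarrow> nat set \<Rightarrow> nat \<Rightarrow> real" where
  "restr \<beta> S = (\<lambda>j. if j \<in> S then \<beta> j else 0)"

definition supp :: "nat \<Rightarrow> (nat \<Rightarrow> real) \<Rightarrow> nat set" where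
  "supp p b = {j\<in>{1..p}. b j \<noteq> 0}"

definition convex_vecs :: "(nat \<Rightarrow> real) set \<Rightarrow> bool" where
  "convex_vecs C \<longleftrightarrow>
     (\<forall>\<beta>\<in>C. \<forall>\<beta>'\<in>C. \<forall>t. 0 \<le> t \<longrightarrow> t \<le> 1 \<longrightarrow> (\<lambda>j. t * \<beta> j + (1 - t) * \<beta>' j) \<in> C)"

(* A function X \<rightarrow> R is a function on the whole type that vanishes outside X. *)
definition normed_function_space ::
    "'x set \<Rightarrow> ('x \<Rightarrow> real) set \<Rightarrow> (('x \<Rightarrow> real) \<Rightarrow> real) \<Rightarrow> bool" where
  "normed_function_space X F N \<longleftrightarrow>
     (\<forall>f\<in>F. \<forall>x. x \<notin> X \<longrightarrow> f x = 0) \<and>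
     (\<lambda>_. 0) \<in> F \<and>
     (\<forall>f\<in>F. \<forall>g\<in>F. (\<lambda>x. f x + g x) \<in> F) \<and>
     (\<forall>f\<in>F. \<forall>c. (\<lambda>x. c * f x) \<in> F) \<and>
     (\<forall>f\<in>F. 0 \<le> N f \<and> (N f = 0 \<longleftrightarrow> f = (\<lambda>_. 0))) \<and>
     (\<forall>f\<in>F. \<forall>g\<in>F. N (\<lambda>x. f x + g x) \<le> N f + N g) \<and>
     (\<forall>f\<in>F. \<forall>c. N (\<lambda>x. c * f x) = \<bar>c\<bar> * N f)"

definition supnorm_on :: "'x set \<Rightarrow> ('x \<Rightarrow> real) \<Rightarrow> ereal" where
  "supnorm_on X f = (SUP x\<in>X. ereal \<bar>f x\<bar>)"

record ('w, 'x) problem =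
  \<Omega>P :: "'w measure"
  XM :: "'x measure"
  YS :: "real set"
  obs :: "nat \<Rightarrow> 'w \<Rightarrow> 'x \<times> real"
  Fsp :: "('x \<Rightarrow> real) set"
  Fnorm :: "('x \<Rightarrow> real) \<Rightarrow> real"
  loss :: "('x \<Rightarrow> real) \<Rightarrow> 'x \<times> real \<Rightarrow> real"
  target :: "'x \<Rightarrow> real"
  dimp :: nat
  psi :: "nat \<Rightarrow> 'x \<Rightarrow> real"
  Phi :: "(nat \<Rightarrow> real) set"
  Gam :: "nat set set"
  lam1 :: real
  lam2 :: real
  eta :: real

definition XS :: "('w, 'x) problem \<Rightarrow> 'x set" where
  "XS Q = space (XM Q)"

definition ZM :: "('w, 'x) problem \<Rightarrow> ('x \<times> real) measure" where
  "ZM Q = XM Q \<Otimes>\<^sub>M restrict_space borel (YS Q)"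

definition emp_risk :: "nat \<Rightarrow> ('w, 'x) problem \<Rightarrow> 'w \<Rightarrow> ('x \<Rightarrow> real) \<Rightarrow> real" where
  "emp_risk n Q \<omega> f = (\<Sum>i=1..n. loss Q f (obs Q i \<omega>)) / real n"

definition risk :: "nat \<Rightarrow> ('w, 'x) problem \<Rightarrow> ('x \<Rightarrow> real) \<Rightarrow> real" where
  "risk n Q f = (\<Sum>i=1..n. (\<integral>\<omega>. loss Q f (obs Q i \<omega>) \<partial>\<Omega>P Q)) / real n"

definition excess :: "nat \<Rightarrow> ('w, 'x) problem \<Rightarrow> ('x \<Rightarrow> real) \<Rightarrow> real" where
  "excess n Q f = risk n Q f - risk n Q (target Q)"

definition lin :: "('w, 'x) problem \<Rightarrow> (nat \<Rightarrow> real) \<Rightarrow> 'x \<Rightarrow> real" where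
  "lin Q \<beta> = (\<lambda>x. \<Sum>j=1..dimp Q. \<beta> j * psi Q j x)"

definition F_local :: "('w, 'x) problem \<Rightarrow> ('x \<Rightarrow> real) set" where
  "F_local Q = {f \<in> Fsp Q. supnorm_on (XS Q) (\<lambda>x. f x - target Q x) \<le> ereal (eta Q)}"

definition setting :: "nat \<Rightarrow> ('w, 'x) problem \<Rightarrow> bool" where
  "setting n Q \<longleftrightarrow>
     prob_space (\<Omega>P Q) \<and>
     prob_space.indep_vars (\<Omega>P Q) (\<lambda>_. ZM Q) (obs Q) {1..n} \<and>
     normed_function_space (XS Q) (Fsp Q) (Fnorm Q) \<and>
     (\<forall>f\<in>Fsp Q. loss Q f \<in> borel_measurable (ZM Q) \<and>
        (\<forall>i\<in>{1..n}. integrable (\<Omega>P Q) (\<lambda>\<omega>. loss Q f (obs Q i \<omega>)))) \<and>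
     (\<forall>f\<in>Fsp Q. \<forall>g\<in>Fsp Q. \<forall>z \<in> XS Q \<times> YS Q. \<forall>t. 0 \<le> t \<longrightarrow> t \<le> 1 \<longrightarrow>
        loss Q (\<lambda>x. t * f x + (1 - t) * g x) z \<le> t * loss Q f z + (1 - t) * loss Q g z) \<and>
     is_arg_min (risk n Q) (\<lambda>f. f \<in> Fsp Q) (target Q) \<and>
     (\<forall>f. is_arg_min (risk n Q) (\<lambda>f. f \<in> Fsp Q) f \<longrightarrow> f = target Q) \<and>
     (\<forall>j\<in>{1..dimp Q}. psi Q j \<in> Fsp Q \<and> psi Q j \<in> borel_measurable (XM Q)) \<and>
     Phi Q \<subseteq> Rvec (dimp Q) \<and> convex_vecs (Phi Q) \<and>
     Gam Q \<subseteq> Pow {1..dimp Q} \<and>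
     lam1 Q > 0 \<and> lam2 Q > 0 \<and> eta Q > 0"

definition is_elastic_net ::
    "nat \<Rightarrow> ('w, 'x) problem \<Rightarrow> 'w \<Rightarrow> (nat \<Rightarrow> real) \<Rightarrow> bool" where
  "is_elastic_net n Q \<omega> b \<longleftrightarrow>
     is_arg_min
       (\<lambda>\<beta>. emp_risk n Q \<omega> (lin Q \<beta>) + lam1 Q * l1norm (dimp Q) \<beta> + lam2 Q * (l2norm (dimp Q) \<beta>)\<^sup>2)
       (\<lambda>\<beta>. \<beta> \<in> Phi Q) b"

definition cone_const :: "('w, 'x) problem \<Rightarrow> (nat \<Rightarrow> real) \<Rightarrow> real" where
  "cone_const Q b = (let S = supp (dimp Q) b in
     3 * (sqrt (real (card S)) + 2 * lam2 Q * l2norm (dimp Q) (restr b S) / lam1 Q))"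

(* For supp b \<noteq> {} the set is nonempty and bounded below, and its infimum is attained.
   For supp b = {} the set is empty; the value is then unspecified but it only ever divides 0
   in penalty_arg, which matches the convention that the minimum is \<infinity>. *)
definition restr_eig_sq :: "('w, 'x) problem \<Rightarrow> (nat \<Rightarrow> real) \<Rightarrow> real" where
  "restr_eig_sq Q b = (let S = supp (dimp Q) b in
     Inf {(Fnorm Q (lin Q \<beta>))\<^sup>2 / (l2norm (dimp Q) (restr \<beta> S))\<^sup>2 | \<beta>.
            \<beta> \<in> Rvec (dimp Q) - {\<lambda>_. 0} \<and>
            l1norm (dimp Q) (restr \<beta> ({1..dimp Q} - S))
              \<le> cone_const Q b * l2norm (dimp Q) (restr \<beta> S)})"

definition restr_eig :: "('w, 'x) problem \<Rightarrow> (nat \<Rightarrow> real) \<Rightarrow> real" where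
  "restr_eig Q b = sqrt (restr_eig_sq Q b)"

(* The division is in ereal: a positive numerator over restr_eig = 0 gives \<infinity>, and 0 / 0 = 0. *)
definition penalty_arg :: "('w, 'x) problem \<Rightarrow> (nat \<Rightarrow> real) \<Rightarrow> ereal" where
  "penalty_arg Q \<beta> =
     ereal (4 * lam1 Q * sqrt (real (card (supp (dimp Q) \<beta>))) + 4 * lam2 Q * l2norm (dimp Q) \<beta>)
       / ereal (restr_eig Q \<beta>)"

definition oracle_obj ::
    "nat \<Rightarrow> (real \<Rightarrow> real) \<Rightarrow> ('w, 'x) problem \<Rightarrow> (nat \<Rightarrow> real) \<Rightarrow> ereal" where
  "oracle_obj n G Q \<beta> = ereal (3 * excess n Q (lin Q \<beta>)) + 2 * conv_conj G (penalty_arg Q \<beta>)"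

definition is_oracle ::
    "nat \<Rightarrow> (real \<Rightarrow> real) \<Rightarrow> ('w, 'x) problem \<Rightarrow> (nat \<Rightarrow> real) \<Rightarrow> bool" where
  "is_oracle n G Q b \<longleftrightarrow>
     is_arg_min (oracle_obj n G Q) (\<lambda>\<beta>. \<beta> \<in> Rvec (dimp Q) \<and> supp (dimp Q) \<beta> \<in> Gam Q) b"

definition M_star ::
    "nat \<Rightarrow> (real \<Rightarrow> real) \<Rightarrow> ('w, 'x) problem \<Rightarrow> (nat \<Rightarrow> real) \<Rightarrow> real \<Rightarrow> ereal" where
  "M_star n G Q b lam0 = (oracle_obj n G Q b / 2) / ereal lam0"

end

(* Everything happens on an event on which the centred empirical process of the losses, over the
   l1-ball of radius R around the oracle, is at most lam0 * R.  Exponential Markov reduces its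
   probability to E exp (max ...).  There the sample points are removed one at a time by
   convexity of exp and a two-point contraction inequality, which leaves a linear process that is
   bounded by the maximum over the p coordinates; with d = 8 * K the exceptional probability is
   at most 2 / p.

   On the event, the minimum property of the estimator gives
     Xi(f) + lam1 |beta - b|_1 <= Xi(f_b) + 3 lam1 sqrt s |(beta - b)_S|_2 + lam0 R.
   In the cone of the restricted eigenvalue, Fenchel's inequality and the margin condition absorb
   the middle term into Xi(f) / 2 + Xi(f_b) / 2 + m; outside the cone the left-hand side absorbs it.
   Convexity transfers the bound from a point of the segment inside the ball to the estimator.

   The sign of G is not prescribed, so the conjugate H(v_n) at
   v_n = 6 lam1 sqrt s / phi need not tend to 0 with v_n.  One
   instead takes m = min (H(v_n)) e, where m <= e is justified for small v_n by
   sigma u <= G u + C with sigma = v_1 and C = H(v_1), and chooses R with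
   lam0 R between 3/2 Xi(f_b) + m and 3/2 Xi(f_b) + e. *)
theory Submission
  imports Defs
begin

section \<open>Exponential moments of Lipschitz empirical processes\<close>

lemma cosh_le_exp_half_square:
  fixes x :: real
  shows "(exp x + exp (- x)) / 2 \<le> exp (x\<^sup>2 / 2)"
proof -
  have nonneg: "(exp y + exp (- y)) / 2 \<le> exp (y\<^sup>2 / 2)" if "y \<ge> 0" for y :: real
  proof -
    \<comment> \<open>The left-hand side is \<open>ln (cosh y)\<close>, the cumulant function of a
      fair sign. The estimate behind Hoeffding's lemma applies with success probability
      \<open>1 / 2\<close> and range \<open>2 * y\<close>; it asks for a nonnegative argument, and
      evenness of cosh covers the rest.\<close>
    have "- y + ln ((1 + exp (2 * y)) / 2) \<le> y\<^sup>2 / 2"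
      using Hoeffdings_lemma_aux[of "2 * y" "1 / 2"] that
      by (simp add: power2_eq_square field_simps)
    then have "exp (- y + ln ((1 + exp (2 * y)) / 2)) \<le> exp (y\<^sup>2 / 2)"
      by simp
    moreover have "exp (- y + ln ((1 + exp (2 * y)) / 2)) = (exp y + exp (- y)) / 2"
    proof -
      have "0 < (1 + exp (2 * y)) / 2" by (simp add: add_pos_pos)
      then have "exp (- y + ln ((1 + exp (2 * y)) / 2)) = exp (- y) * ((1 + exp (2 * y)) / 2)"
        by (simp only: exp_add exp_ln)
      also have "\<dots> = (exp y + exp (- y)) / 2"
        by (simp add: field_simps flip: exp_add)
      finally show ?thesis .
    qed
    ultimately show ?thesis by metis
  qed
  show ?thesis
    using nonneg[of x] nonneg[of "- x"] by (cases "x \<ge> 0") (auto simp: add.commute)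
qed

text \<open>The increment factors as \<open>exp x * (exp a - 1)\<close>, which grows in both
  arguments once the larger second factor is nonnegative. Only \<open>b\<close>, not
  \<open>a\<close>, has to be nonnegative for this.\<close>

lemma exp_increment_mono:
  fixes x y a b :: real
  assumes "x \<le> y" "a \<le> b" "0 \<le> b"
  shows "exp (x + a) - exp x \<le> exp (y + b) - exp y"
proof -
  have "exp (x + a) - exp x = exp x * (exp a - 1)"
    by (simp add: exp_add algebra_simps)
  also have "\<dots> \<le> exp x * (exp b - 1)"
    using assms by (intro mult_left_mono) auto
  also have "\<dots> \<le> exp y * (exp b - 1)"
    using assms by (intro mult_right_mono) auto
  also have "\<dots> = exp (y + b) - exp y"
    by (simp add: exp_add algebra_simps)
  finally show ?thesis .
qed

text \<open>Here \<open>(a, q)\<close> and \<open>(a', q')\<close> belong to the maximizers of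
  \<open>A + q\<close> and of \<open>A - q\<close>; the last two hypotheses record this maximality.
  Depending on the signs and the order of \<open>h\<close> and \<open>h'\<close>, the larger sum
  keeps the two signs or exchanges them, hence the maximum on the right.\<close>

lemma exp_contraction_two_points:
  fixes a a' q q' h h' :: real
  assumes q: "\<bar>q\<bar> \<le> \<bar>h\<bar>" "\<bar>q'\<bar> \<le> \<bar>h'\<bar>" and diff: "\<bar>q - q'\<bar> \<le> \<bar>h - h'\<bar>"
    and max: "a' + q' \<le> a + q" "a - q \<le> a' - q'"
  shows "exp (a + q) + exp (a' - q')
           \<le> max (exp (a + h) + exp (a' - h')) (exp (a' + h') + exp (a - h))"
proof -
  \<comment> \<open>Negating both \<open>h\<close> and \<open>h'\<close> exchanges the two
    candidates in the maximum and preserves the hypotheses, so the first of them may be taken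
    nonnegative.\<close>
  have ordered: "exp (a + q) + exp (a' - q')
      \<le> max (exp (a + k) + exp (a' - k')) (exp (a' + k') + exp (a - k))"
    if "\<bar>k\<bar> = \<bar>h\<bar>" "\<bar>k'\<bar> = \<bar>h'\<bar>" "\<bar>k - k'\<bar> = \<bar>h - h'\<bar>" "0 \<le> k" for k k' :: real
  proof -
    have k: "\<bar>q\<bar> \<le> k" "\<bar>q'\<bar> \<le> \<bar>k'\<bar>" "\<bar>q - q'\<bar> \<le> \<bar>k - k'\<bar>"
      using that q diff by simp_all
    show ?thesis
    proof (cases "k' \<le> k")
      case True
      have "exp ((a' - k') + (k' - q')) - exp (a' - k') \<le> exp ((a + q) + (k - q)) - exp (a + q)"
      proof (cases "0 \<le> k'")
        case True
        \<comment> \<open>Maximality only orders the base points of the two increments: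
          \<open>a' - k' \<le> a' + q' \<le> a + q\<close>. The Lipschitz hypothesis orders their
          lengths.\<close>
        then have "q \<le> k" "- k' \<le> q'" "q - q' \<le> k - k'" using k True \<open>k' \<le> k\<close> by auto
        then show ?thesis using max by (intro exp_increment_mono; linarith)
      next
        case False
        then have "exp (a' - q') - exp (a' - k') \<le> 0" "0 \<le> exp (a + k) - exp (a + q)"
          using k by auto
        then have "exp (a' - q') - exp (a' - k') \<le> exp (a + k) - exp (a + q)"
          by (rule order_trans)
        then show ?thesis by simp
      qed
      then show ?thesis by (simp add: algebra_simps)
    next
      case False
      then have "q \<le> k" "- k' \<le> q'" "q - q' \<le> k' - k" using k \<open>0 \<le> k\<close> by auto
      then have "exp ((a - k) + (k + q)) - exp (a - k) \<le> exp ((a' - q') + (k' + q')) - exp (a' - q')"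
        using False max \<open>0 \<le> k\<close> by (intro exp_increment_mono; linarith)
      then show ?thesis by (simp add: algebra_simps)
    qed
  qed
  show ?thesis
  proof (cases "0 \<le> h")
    case True
    then show ?thesis using ordered[of h h'] by simp
  next
    case False
    then show ?thesis using ordered[of "- h" "- h'"] by (simp add: max.commute add.commute)
  qed
qed

text \<open>One coordinate of the Ledoux-Talagrand contraction principle. The two maxima on the left
  are attained at some \<open>t\<close> and \<open>t'\<close>; after the two-point inequality, each
  exponent of either candidate is one of the competitors in a maximum on the right.\<close>

lemma exp_Max_contraction:
  fixes A q h :: "'t \<Rightarrow> real"
  assumes T: "finite T" "T \<noteq> {}"
    and q: "\<And>t. t \<in> T \<Longrightarrow> \<bar>q t\<bar> \<le> \<bar>h t\<bar>"
    and diff: "\<And>t t'. t \<in> T \<Longrightarrow> t' \<in> T \<Longrightarrow> \<bar>q t - q t'\<bar> \<le> \<bar>h t - h t'\<bar>"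
  shows "exp (MAX t\<in>T. A t + q t) + exp (MAX t\<in>T. A t - q t)
           \<le> exp (MAX t\<in>T. A t + h t) + exp (MAX t\<in>T. A t - h t)"
proof -
  have fin: "finite ((\<lambda>t. f t) ` T)" "(\<lambda>t. f t) ` T \<noteq> {}" for f :: "'t \<Rightarrow> real"
    using T by auto
  obtain t where t: "t \<in> T" "(MAX t\<in>T. A t + q t) = A t + q t"
    using Max_in[OF fin, of "\<lambda>t. A t + q t"] by auto
  obtain t' where t': "t' \<in> T" "(MAX t\<in>T. A t - q t) = A t' - q t'"
    using Max_in[OF fin, of "\<lambda>t. A t - q t"] by auto
  have ge: "f s \<le> (MAX t\<in>T. f t)" if "s \<in> T" for f :: "'t \<Rightarrow> real" and s
    using fin that by (intro Max_ge) auto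
  have le: "exp (f s) \<le> exp (MAX t\<in>T. f t)" if "s \<in> T" for f :: "'t \<Rightarrow> real" and s
    using ge[OF that] by simp
  have "exp (A t + q t) + exp (A t' - q t')
      \<le> max (exp (A t + h t) + exp (A t' - h t')) (exp (A t' + h t') + exp (A t - h t))"
    using ge[OF t'(1), of "\<lambda>t. A t + q t"] ge[OF t(1), of "\<lambda>t. A t - q t"]
    unfolding t(2) t'(2) by (intro exp_contraction_two_points q diff t(1) t'(1))
  also have "\<dots> \<le> exp (MAX t\<in>T. A t + h t) + exp (MAX t\<in>T. A t - h t)"
    using le[OF t(1), of "\<lambda>t. A t + h t"] le[OF t(1), of "\<lambda>t. A t - h t"]
      le[OF t'(1), of "\<lambda>t. A t + h t"] le[OF t'(1), of "\<lambda>t. A t - h t"]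
    by (simp add: add_mono)
  finally show ?thesis using t t' by simp
qed

text \<open>Splitting \<open>A t + (E - g) = ((A t + 2 E) + (A t - 2 g)) / 2\<close> by convexity of \<open>exp\<close>
  replaces the usual ghost sample and Rademacher signs.\<close>
lemma (in prob_space) nn_integral_exp_Max_symmetrization:
  fixes A :: "'t \<Rightarrow> real" and g :: "'t \<Rightarrow> 'a \<Rightarrow> real"
  assumes T: "finite T" "T \<noteq> {}"
    and meas: "\<And>t. t \<in> T \<Longrightarrow> g t \<in> borel_measurable M"
    and bound: "\<And>t z. t \<in> T \<Longrightarrow> z \<in> space M \<Longrightarrow> \<bar>g t z\<bar> \<le> B"
  shows "(\<integral>\<^sup>+z. ennreal (exp (MAX t\<in>T. A t + (expectation (g t) - g t z))) \<partial>M)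
    \<le> (\<integral>\<^sup>+z. ennreal ((exp (MAX t\<in>T. A t + 2 * g t z) + exp (MAX t\<in>T. A t - 2 * g t z)) / 2) \<partial>M)"
proof -
  define U where "U z = exp (MAX t\<in>T. A t + 2 * g t z)" for z
  define V where "V z = exp (MAX t\<in>T. A t - 2 * g t z)" for z
  have fin: "finite (f ` T)" "f ` T \<noteq> {}" for f :: "'t \<Rightarrow> real"
    using T by auto
  have ge: "f s \<le> (MAX t\<in>T. f t)" if "s \<in> T" for f :: "'t \<Rightarrow> real" and s
    using fin that by (intro Max_ge) auto
  have U_meas: "U \<in> borel_measurable M" and V_meas: "V \<in> borel_measurable M"
    unfolding U_def V_def using T meas by (auto intro!: borel_measurable_exp borel_measurable_Max)
  have bnd: "A t + 2 * g t z \<le> (MAX t\<in>T. A t) + 2 * B" "A t - 2 * g t z \<le> (MAX t\<in>T. A t) + 2 * B"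
    if "t \<in> T" "z \<in> space M" for t z
    using ge[OF that(1), of A] bound[OF that] by linarith+
  have UV_le: "U z \<le> exp ((MAX t\<in>T. A t) + 2 * B)" "V z \<le> exp ((MAX t\<in>T. A t) + 2 * B)"
    if "z \<in> space M" for z
    unfolding U_def V_def using fin bnd that by (auto intro!: Max.boundedI)
  have intU: "integrable M U" and intV: "integrable M V"
    using U_meas V_meas UV_le
    by (auto intro!: integrable_const_bound[where B = "exp ((MAX t\<in>T. A t) + 2 * B)"]
        simp: U_def V_def)
  \<comment> \<open>Jensen is applied at each fixed index, and the resulting bound
    \<open>expectation U\<close> is the same for all indices. It therefore survives the choice of a
    maximizer depending on \<open>z\<close> below.\<close>
  have jensen: "exp (A t + 2 * expectation (g t)) \<le> expectation U" if t: "t \<in> T" for t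
  proof -
    have intg: "integrable M (g t)"
      using meas bound t by (auto intro!: integrable_const_bound[where B = B])
    have int1: "integrable M (\<lambda>z. exp (A t + 2 * g t z))"
      using meas bnd t
      by (auto intro!: integrable_const_bound[where B = "exp ((MAX t\<in>T. A t) + 2 * B)"])
    have "exp (expectation (\<lambda>z. A t + 2 * g t z)) \<le> expectation (\<lambda>z. exp (A t + 2 * g t z))"
      using intg int1 exp_convex by (intro jensens_inequality[where I = UNIV]) auto
    also have "\<dots> \<le> expectation U"
      using int1 intU ge[OF t, of "\<lambda>t. A t + 2 * g t _"]
      by (intro integral_mono) (auto simp: U_def)
    finally show ?thesis using intg by (simp add: prob_space)
  qed
  have point: "exp (MAX t\<in>T. A t + (expectation (g t) - g t z)) \<le> expectation U / 2 + V z / 2" for z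
  proof -
    obtain t where t: "t \<in> T"
        "(MAX t\<in>T. A t + (expectation (g t) - g t z)) = A t + (expectation (g t) - g t z)"
      using Max_in[OF fin, of "\<lambda>t. A t + (expectation (g t) - g t z)"] by auto
    have "exp ((1 - 1/2) *\<^sub>R (A t + 2 * expectation (g t)) + (1/2) *\<^sub>R (A t - 2 * g t z))
        \<le> (1 - 1/2) * exp (A t + 2 * expectation (g t)) + (1/2) * exp (A t - 2 * g t z)"
      using exp_convex by (intro convex_onD[where A = UNIV]) auto
    also have "\<dots> \<le> expectation U / 2 + V z / 2"
      using jensen[OF t(1)] exp_le_cancel_iff[THEN iffD2, OF ge[OF t(1), of "\<lambda>t. A t - 2 * g t z"]]
      by (simp add: V_def del: exp_le_cancel_iff)
    finally show ?thesis unfolding t(2) by (simp add: algebra_simps)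
  qed
  have nonneg: "0 \<le> U z" "0 \<le> V z" for z by (auto simp: U_def V_def)
  have "(\<integral>\<^sup>+z. ennreal (exp (MAX t\<in>T. A t + (expectation (g t) - g t z))) \<partial>M)
      \<le> (\<integral>\<^sup>+z. ennreal (expectation U / 2 + V z / 2) \<partial>M)"
    by (intro nn_integral_mono ennreal_leI point)
  also have "\<dots> = ennreal (expectation (\<lambda>z. expectation U / 2 + V z / 2))"
    using intV nonneg by (intro nn_integral_eq_integral) (auto intro!: AE_I2 add_nonneg_nonneg integral_nonneg)
  also have "expectation (\<lambda>z. expectation U / 2 + V z / 2) = expectation (\<lambda>z. (U z + V z) / 2)"
    using intU intV by (simp add: prob_space add_divide_distrib)
  also have "ennreal \<dots> = (\<integral>\<^sup>+z. ennreal ((U z + V z) / 2) \<partial>M)"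
    using intU intV nonneg by (intro nn_integral_eq_integral[symmetric]) auto
  finally show ?thesis by (simp add: U_def V_def)
qed

text \<open>The linear term with free coefficients \<open>w\<close> makes the induction over the sample work: each
  symmetrized and contracted coordinate \<open>z\<close> only shifts \<open>w\<close> by \<open>2 * D * \<psi> j z\<close>, up to sign.\<close>
lemma nn_integral_exp_Max_process:
  fixes \<mu> :: "'i \<Rightarrow> 'z measure" and g :: "'t \<Rightarrow> 'z \<Rightarrow> real" and v :: "'t \<Rightarrow> 'j \<Rightarrow> real"
    and \<psi> :: "'j \<Rightarrow> 'z \<Rightarrow> real" and w :: "'j \<Rightarrow> real" and D K R :: real
  assumes \<mu>: "\<And>i. prob_space (\<mu> i)" "\<And>i. sets (\<mu> i) = sets N"
    and T: "finite T" "T \<noteq> {}" and J: "finite J" "J \<noteq> {}"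
    and g_meas: "\<And>t. t \<in> T \<Longrightarrow> g t \<in> borel_measurable N"
    and \<psi>_meas: "\<And>j. j \<in> J \<Longrightarrow> \<psi> j \<in> borel_measurable N"
    and \<psi>_bound: "\<And>j z. j \<in> J \<Longrightarrow> z \<in> space N \<Longrightarrow> \<bar>\<psi> j z\<bar> \<le> K"
    and v_bound: "\<And>t. t \<in> T \<Longrightarrow> (\<Sum>j\<in>J. \<bar>v t j\<bar>) \<le> R"
    and nonneg: "0 \<le> D" "0 \<le> K" "0 \<le> R"
    and g_lip0: "\<And>t z. t \<in> T \<Longrightarrow> z \<in> space N \<Longrightarrow> \<bar>g t z\<bar> \<le> D * \<bar>\<Sum>j\<in>J. v t j * \<psi> j z\<bar>"
    and g_lip: "\<And>t t' z. t \<in> T \<Longrightarrow> t' \<in> T \<Longrightarrow> z \<in> space N \<Longrightarrow>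
        \<bar>g t z - g t' z\<bar> \<le> D * \<bar>(\<Sum>j\<in>J. v t j * \<psi> j z) - (\<Sum>j\<in>J. v t' j * \<psi> j z)\<bar>"
    and I: "finite I"
  shows "(\<integral>\<^sup>+x. ennreal (exp (MAX t\<in>T. (\<Sum>j\<in>J. w j * v t j)
            + (\<Sum>i\<in>I. (\<integral>z. g t z \<partial>\<mu> i) - g t (x i)))) \<partial>Pi\<^sub>M I \<mu>)
    \<le> ennreal (exp ((2 * D * R * K)\<^sup>2 / 2) ^ card I * (\<Sum>j\<in>J. exp (R * w j) + exp (- (R * w j))))"
  using I
proof (induction I arbitrary: w rule: finite_induct)
  case empty
  \<comment> \<open>Duality of the l1 and sup norms: over the ball, the linear functional is
    controlled by its largest coefficient, hence by one of the signed vertices.\<close>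
  have dual: "(\<Sum>j\<in>J. w j * v t j) \<le> R * (MAX j\<in>J. \<bar>w j\<bar>)" if "t \<in> T" for t
  proof -
    have "(\<Sum>j\<in>J. w j * v t j) \<le> (\<Sum>j\<in>J. (MAX j\<in>J. \<bar>w j\<bar>) * \<bar>v t j\<bar>)"
    proof (intro sum_mono)
      fix j assume "j \<in> J"
      have "w j * v t j \<le> \<bar>w j\<bar> * \<bar>v t j\<bar>" by (simp flip: abs_mult)
      also have "\<dots> \<le> (MAX j\<in>J. \<bar>w j\<bar>) * \<bar>v t j\<bar>"
        using J \<open>j \<in> J\<close> by (intro mult_right_mono Max_ge) auto
      finally show "w j * v t j \<le> (MAX j\<in>J. \<bar>w j\<bar>) * \<bar>v t j\<bar>" .
    qed
    also have "\<dots> = (MAX j\<in>J. \<bar>w j\<bar>) * (\<Sum>j\<in>J. \<bar>v t j\<bar>)" by (simp add: sum_distrib_left)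
    also have "\<dots> \<le> (MAX j\<in>J. \<bar>w j\<bar>) * R"
    proof (intro mult_left_mono v_bound that)
      obtain j where "j \<in> J" using J by auto
      then have "\<bar>w j\<bar> \<le> (MAX j\<in>J. \<bar>w j\<bar>)" using J by (intro Max_ge) auto
      then show "0 \<le> (MAX j\<in>J. \<bar>w j\<bar>)" by linarith
    qed
    finally show ?thesis by (simp add: mult.commute)
  qed
  obtain k where k: "k \<in> J" "(MAX j\<in>J. \<bar>w j\<bar>) = \<bar>w k\<bar>"
    using Max_in[of "(\<lambda>j. \<bar>w j\<bar>) ` J"] J by (metis (mono_tags) finite_imageI image_iff image_is_empty)
  have "exp (MAX t\<in>T. (\<Sum>j\<in>J. w j * v t j)) \<le> exp (R * \<bar>w k\<bar>)"
    using dual T k by (auto intro!: Max.boundedI)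
  also have "\<dots> \<le> exp (R * w k) + exp (- (R * w k))"
    by (cases "0 \<le> w k") auto
  also have "\<dots> \<le> (\<Sum>j\<in>J. exp (R * w j) + exp (- (R * w j)))"
    using J k by (intro member_le_sum) (auto intro!: add_nonneg_nonneg)
  finally show ?case by (simp add: PiM_empty ennreal_leI)
next
  case (insert k I)
  interpret prob: prob_space "\<mu> i" for i by (rule \<mu>)
  interpret product_sigma_finite \<mu> by unfold_locales
  have space[simp]: "space (\<mu> i) = space N" for i
    by (rule sets_eq_imp_space_eq) (rule \<mu>)
  have meas: "f \<in> borel_measurable (\<mu> i) \<longleftrightarrow> f \<in> borel_measurable N" for f :: "'z \<Rightarrow> real" and i
    by (rule arg_cong[where f = "\<lambda>A. f \<in> A"], rule measurable_cong_sets) (simp_all add: \<mu>)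
  have comp: "(\<lambda>x. f (x i)) \<in> borel_measurable (Pi\<^sub>M I' \<mu>)"
    if "i \<in> I'" "f \<in> borel_measurable N" for f :: "'z \<Rightarrow> real" and i I'
    using that meas by (intro measurable_compose[OF measurable_component_singleton]) auto
  define Q where "Q = exp ((2 * D * R * K)\<^sup>2 / 2)"
  \<comment> \<open>\<open>C w\<close> sums the exponential of the linear functional
    \<open>w\<close> over the vertices of the l1-ball of radius \<open>R\<close>. Unlike a maximum,
    this sum behaves multiplicatively when \<open>w\<close> is shifted by opposite signs and
    averaged.\<close>
  define C where "C w = (\<Sum>j\<in>J. exp (R * w j) + exp (- (R * w j)))" for w
  define e where "e i t z = (\<integral>z. g t z \<partial>\<mu> i) - g t z" for i t z
  define E where "E w I x = exp (MAX t\<in>T. (\<Sum>j\<in>J. w j * v t j) + (\<Sum>i\<in>I. e i t (x i)))" for w I x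
  define W where "W s z j = w j + s * (2 * D * \<psi> j z)" for s z j
  have Q: "0 \<le> Q" and C: "0 \<le> C w" and E: "0 \<le> E w I x" for w I x
    by (auto simp: Q_def C_def E_def intro!: sum_nonneg add_nonneg_nonneg)
  have IH: "(\<integral>\<^sup>+x. ennreal (E w I x) \<partial>Pi\<^sub>M I \<mu>) \<le> ennreal (Q ^ card I * C w)" for w
    using insert.IH[of w] by (simp add: E_def e_def Q_def C_def)
  have E_meas[measurable]: "E w I' \<in> borel_measurable (Pi\<^sub>M I' \<mu>)" if "finite I'" for w I'
    unfolding E_def e_def using T that
    by (intro measurable_compose[OF _ borel_measurable_exp] borel_measurable_Max borel_measurable_add
        borel_measurable_sum borel_measurable_diff borel_measurable_const comp g_meas)
  define G where "G x = (E (W 1 (x k)) I x + E (W (- 1) (x k)) I x) / 2" for x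
  have G_meas: "(\<lambda>x. ennreal (G x)) \<in> borel_measurable (Pi\<^sub>M (insert k I) \<mu>)"
    unfolding G_def E_def e_def W_def using T insert.hyps J
    by (intro measurable_compose[OF _ measurable_ennreal] borel_measurable_divide borel_measurable_add
        measurable_compose[OF _ borel_measurable_exp] borel_measurable_Max borel_measurable_sum
        borel_measurable_diff borel_measurable_times borel_measurable_const comp g_meas \<psi>_meas) auto
  have W_sum: "(\<Sum>j\<in>J. W s z j * v t j) = (\<Sum>j\<in>J. w j * v t j) + s * (2 * D * (\<Sum>j\<in>J. v t j * \<psi> j z))"
    for s z t
    by (simp add: W_def sum.distrib sum_distrib_left algebra_simps)
  have upd: "E w' I (x(k := y)) = E w' I x" for w' x y
  proof -
    have "(\<Sum>i\<in>I. e i t ((x(k := y)) i)) = (\<Sum>i\<in>I. e i t (x i))" for t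
      using insert.hyps by (intro sum.cong) auto
    then show ?thesis unfolding E_def by simp
  qed
  \<comment> \<open>Coordinate \<open>k\<close> is treated with all others frozen: symmetrization
    first, then contraction of \<open>2 * g\<close> to the linear function with factor
    \<open>2 * D\<close>.\<close>
  have step: "(\<integral>\<^sup>+y. ennreal (E w (insert k I) (x(k := y))) \<partial>\<mu> k) \<le> (\<integral>\<^sup>+y. ennreal (G (x(k := y))) \<partial>\<mu> k)"
    for x
  proof -
    define A where "A t = (\<Sum>j\<in>J. w j * v t j) + (\<Sum>i\<in>I. e i t (x i))" for t
    have sum_upd: "(\<Sum>i\<in>I. e i t ((x(k := y)) i)) = (\<Sum>i\<in>I. e i t (x i))" for t y
      using insert.hyps by (intro sum.cong) auto
    have "E w (insert k I) (x(k := y)) = exp (MAX t\<in>T. A t + ((\<integral>z. g t z \<partial>\<mu> k) - g t y))" for y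
      using insert.hyps sum_upd unfolding E_def A_def by (simp add: e_def algebra_simps)
    then have "(\<integral>\<^sup>+y. ennreal (E w (insert k I) (x(k := y))) \<partial>\<mu> k)
        = (\<integral>\<^sup>+y. ennreal (exp (MAX t\<in>T. A t + ((\<integral>z. g t z \<partial>\<mu> k) - g t y))) \<partial>\<mu> k)"
      by simp
    also have "\<dots> \<le> (\<integral>\<^sup>+y. ennreal ((exp (MAX t\<in>T. A t + 2 * g t y) + exp (MAX t\<in>T. A t - 2 * g t y)) / 2) \<partial>\<mu> k)"
    proof (rule prob.nn_integral_exp_Max_symmetrization[OF T])
      fix t z assume t: "t \<in> T" and z: "z \<in> space (\<mu> k)"
      have "\<bar>\<Sum>j\<in>J. v t j * \<psi> j z\<bar> \<le> (\<Sum>j\<in>J. \<bar>v t j\<bar> * K)"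
        using \<psi>_bound z by (auto simp: abs_mult intro!: sum_abs[THEN order_trans] sum_mono mult_left_mono)
      also have "\<dots> \<le> R * K"
        using v_bound[OF t] nonneg by (simp add: mult_right_mono flip: sum_distrib_right)
      finally show "\<bar>g t z\<bar> \<le> D * (R * K)"
        using z nonneg by (intro order_trans[OF g_lip0[OF t] mult_left_mono]) auto
    qed (simp add: meas g_meas)
    also have "\<dots> \<le> (\<integral>\<^sup>+y. ennreal (G (x(k := y))) \<partial>\<mu> k)"
    proof (intro nn_integral_mono ennreal_leI)
      fix y assume "y \<in> space (\<mu> k)"
      then have y: "y \<in> space N" by simp
      have "exp (MAX t\<in>T. A t + 2 * g t y) + exp (MAX t\<in>T. A t - 2 * g t y)
          \<le> exp (MAX t\<in>T. A t + 2 * D * (\<Sum>j\<in>J. v t j * \<psi> j y))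
            + exp (MAX t\<in>T. A t - 2 * D * (\<Sum>j\<in>J. v t j * \<psi> j y))"
      proof (rule exp_Max_contraction[OF T])
        fix t t' assume t: "t \<in> T" "t' \<in> T"
        show "\<bar>2 * g t y\<bar> \<le> \<bar>2 * D * (\<Sum>j\<in>J. v t j * \<psi> j y)\<bar>"
          using g_lip0[OF t(1) y] nonneg by (simp add: abs_mult)
        show "\<bar>2 * g t y - 2 * g t' y\<bar>
            \<le> \<bar>2 * D * (\<Sum>j\<in>J. v t j * \<psi> j y) - 2 * D * (\<Sum>j\<in>J. v t' j * \<psi> j y)\<bar>"
          unfolding right_diff_distrib[symmetric] abs_mult using g_lip[OF t y] nonneg by simp
      qed
      also have "\<dots> = 2 * G (x(k := y))"
      proof -
        have "A t + 2 * D * (\<Sum>j\<in>J. v t j * \<psi> j y) = (\<Sum>j\<in>J. W 1 y j * v t j) + (\<Sum>i\<in>I. e i t (x i))"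
            "A t - 2 * D * (\<Sum>j\<in>J. v t j * \<psi> j y) = (\<Sum>j\<in>J. W (- 1) y j * v t j) + (\<Sum>i\<in>I. e i t (x i))"
          for t
          unfolding W_sum A_def by simp_all
        then show ?thesis unfolding G_def upd fun_upd_same unfolding E_def by simp
      qed
      finally show "(exp (MAX t\<in>T. A t + 2 * g t y) + exp (MAX t\<in>T. A t - 2 * g t y)) / 2 \<le> G (x(k := y))"
        by simp
    qed
    finally show ?thesis .
  qed
  have "(\<integral>\<^sup>+x. ennreal (E w (insert k I) x) \<partial>Pi\<^sub>M (insert k I) \<mu>)
      = (\<integral>\<^sup>+x. \<integral>\<^sup>+y. ennreal (E w (insert k I) (x(k := y))) \<partial>\<mu> k \<partial>Pi\<^sub>M I \<mu>)"
    using insert.hyps by (intro product_nn_integral_insert) auto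
  also have "\<dots> \<le> (\<integral>\<^sup>+x. \<integral>\<^sup>+y. ennreal (G (x(k := y))) \<partial>\<mu> k \<partial>Pi\<^sub>M I \<mu>)"
    by (intro nn_integral_mono step)
  \<comment> \<open>The order of integration is exchanged so that \<open>y\<close> is fixed inside.
    The induction hypothesis then applies to the shifted weights \<open>W 1 y\<close> and
    \<open>W (- 1) y\<close>, which is why it must hold for every \<open>w\<close>.\<close>
  also have "\<dots> = (\<integral>\<^sup>+y. \<integral>\<^sup>+x. ennreal (G (x(k := y))) \<partial>Pi\<^sub>M I \<mu> \<partial>\<mu> k)"
    using product_nn_integral_insert[OF insert.hyps G_meas] product_nn_integral_insert_rev[OF insert.hyps G_meas]
    by (rule trans[OF sym])
  also have "\<dots> \<le> (\<integral>\<^sup>+y. ennreal (Q ^ card (insert k I) * C w) \<partial>\<mu> k)"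
  proof (intro nn_integral_mono)
    fix y assume "y \<in> space (\<mu> k)"
    then have y: "y \<in> space N" by simp
    define h where "h = (1 / 2 :: real)"
    then have h: "0 \<le> h" "c / 2 = h * c" for c :: real by auto
    have "ennreal (G (x(k := y))) = ennreal h * (ennreal (E (W 1 y) I x) + ennreal (E (W (- 1) y) I x))"
      for x
      unfolding G_def upd fun_upd_same h(2) using E h(1)
      by (simp add: ennreal_plus[symmetric] ennreal_mult[symmetric] algebra_simps del: ennreal_plus)
    then have "(\<integral>\<^sup>+x. ennreal (G (x(k := y))) \<partial>Pi\<^sub>M I \<mu>)
        = ennreal h * ((\<integral>\<^sup>+x. ennreal (E (W 1 y) I x) \<partial>Pi\<^sub>M I \<mu>)
            + (\<integral>\<^sup>+x. ennreal (E (W (- 1) y) I x) \<partial>Pi\<^sub>M I \<mu>))"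
      using insert.hyps by (simp add: nn_integral_cmult nn_integral_add)
    also have "\<dots> \<le> ennreal h * (ennreal (Q ^ card I * C (W 1 y)) + ennreal (Q ^ card I * C (W (- 1) y)))"
      by (intro mult_left_mono add_mono IH) auto
    also have "\<dots> = ennreal (Q ^ card I * ((C (W 1 y) + C (W (- 1) y)) / 2))"
      unfolding h(2) using Q C h(1) by (simp add: ennreal_plus[symmetric] ennreal_mult[symmetric] algebra_simps del: ennreal_plus)
    also have "\<dots> \<le> ennreal (Q ^ card I * (Q * C w))"
    proof (intro ennreal_leI mult_left_mono)
      have cosh_le: "(exp c + exp (- c)) / 2 \<le> Q" if "\<bar>c\<bar> \<le> 2 * D * R * K" for c
      proof -
        have "c\<^sup>2 \<le> (2 * D * R * K)\<^sup>2" using power_mono[OF that, of 2] by simp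
        then show ?thesis
          using cosh_le_exp_half_square[of c] unfolding Q_def by (smt (verit) exp_le_cancel_iff divide_right_mono)
      qed
      \<comment> \<open>Addition formula
        \<open>cosh (x + y) + cosh (x - y) = 2 * cosh x * cosh y\<close>, term by term; the factor
        produced by the shift is at most \<open>Q\<close>.\<close>
      have "(C (W 1 y) + C (W (- 1) y)) / 2
          = (\<Sum>j\<in>J. ((exp (2 * D * R * \<psi> j y) + exp (- (2 * D * R * \<psi> j y))) / 2)
              * (exp (R * w j) + exp (- (R * w j))))"
        unfolding C_def W_def sum.distrib[symmetric] sum_divide_distrib
        by (intro sum.cong refl) (simp add: field_simps flip: exp_add)
      also have "\<dots> \<le> (\<Sum>j\<in>J. Q * (exp (R * w j) + exp (- (R * w j))))"
      proof (intro sum_mono mult_right_mono cosh_le)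
        fix j assume "j \<in> J"
        then show "\<bar>2 * D * R * \<psi> j y\<bar> \<le> 2 * D * R * K"
          using \<psi>_bound[OF _ y] nonneg by (auto simp: abs_mult intro!: mult_left_mono)
      qed (auto intro!: add_nonneg_nonneg)
      also have "\<dots> = Q * C w" by (simp add: C_def sum_distrib_left)
      finally show "(C (W 1 y) + C (W (- 1) y)) / 2 \<le> Q * C w" .
    qed (use Q in auto)
    also have "\<dots> = ennreal (Q ^ card (insert k I) * C w)"
      using insert.hyps by (simp add: algebra_simps)
    finally show "(\<integral>\<^sup>+x. ennreal (G (x(k := y))) \<partial>Pi\<^sub>M I \<mu>) \<le> ennreal (Q ^ card (insert k I) * C w)" .
  qed
  also have "\<dots> = ennreal (Q ^ card (insert k I) * C w)"
    by (simp add: prob.emeasure_space_1 del: space)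
  finally show ?case by (simp add: E_def e_def Q_def C_def)
qed

section \<open>Tail bounds: exponential Markov inequality and discretization\<close>

text \<open>The moment bound with zero weights and with \<open>\<tau> * g\<close> in place of
  \<open>g\<close> gives the factor \<open>2 * card J\<close>, two vertices per coordinate.
  Independence turns the product integral into an expectation over the sample, and the exponential
  Markov inequality finishes.\<close>

lemma (in prob_space) finite_lipschitz_process_tail:
  fixes Z :: "'i \<Rightarrow> 'a \<Rightarrow> 'z" and g :: "'t \<Rightarrow> 'z \<Rightarrow> real" and v :: "'t \<Rightarrow> 'j \<Rightarrow> real"
    and \<psi> :: "'j \<Rightarrow> 'z \<Rightarrow> real" and D K R x :: real
  assumes indep: "indep_vars (\<lambda>_. N) Z I" and I: "finite I" "I \<noteq> {}"
    and T: "finite T" and J: "finite J" "J \<noteq> {}"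
    and g_meas: "\<And>t. t \<in> T \<Longrightarrow> g t \<in> borel_measurable N"
    and \<psi>_meas: "\<And>j. j \<in> J \<Longrightarrow> \<psi> j \<in> borel_measurable N"
    and \<psi>_bound: "\<And>j z. j \<in> J \<Longrightarrow> z \<in> space N \<Longrightarrow> \<bar>\<psi> j z\<bar> \<le> K"
    and v_bound: "\<And>t. t \<in> T \<Longrightarrow> (\<Sum>j\<in>J. \<bar>v t j\<bar>) \<le> R"
    and pos: "0 < D" "0 < K" "0 < R" "0 < x"
    and g_lip0: "\<And>t z. t \<in> T \<Longrightarrow> z \<in> space N \<Longrightarrow> \<bar>g t z\<bar> \<le> D * \<bar>\<Sum>j\<in>J. v t j * \<psi> j z\<bar>"
    and g_lip: "\<And>t t' z. t \<in> T \<Longrightarrow> t' \<in> T \<Longrightarrow> z \<in> space N \<Longrightarrow>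
        \<bar>g t z - g t' z\<bar> \<le> D * \<bar>(\<Sum>j\<in>J. v t j * \<psi> j z) - (\<Sum>j\<in>J. v t' j * \<psi> j z)\<bar>"
  shows "prob {\<omega> \<in> space M. \<exists>t\<in>T. x < (\<Sum>i\<in>I. expectation (\<lambda>\<omega>. g t (Z i \<omega>)) - g t (Z i \<omega>))}
    \<le> 2 * card J * exp (- (x\<^sup>2 / (8 * card I * (D * R * K)\<^sup>2)))"
proof (cases "T = {}")
  case True
  then show ?thesis by simp
next
  case False
  have rv[measurable]: "Z i \<in> measurable M N" if "i \<in> I" for i
    using indep that by (simp add: indep_vars_def)
  obtain i0 where i0: "i0 \<in> I" using I by auto
  \<comment> \<open>The moment bound wants a probability measure at every index, while
    \<open>Z i\<close> is known to be measurable only for \<open>i\<close> in \<open>I\<close>;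
    outside, the law at \<open>i0\<close> is substituted.\<close>
  define \<mu> where "\<mu> i = distr M N (Z (if i \<in> I then i else i0))" for i
  \<comment> \<open>The minimizer of the final exponent
    \<open>2 * m * \<tau>\<^sup>2 * (D * R * K)\<^sup>2 - \<tau> * x\<close>.\<close>
  define \<tau> where "\<tau> = x / (4 * card I * (D * R * K)\<^sup>2)"
  define S where "S t \<omega> = (\<Sum>i\<in>I. expectation (\<lambda>\<omega>. g t (Z i \<omega>)) - g t (Z i \<omega>))" for t \<omega>
  define m where "m = real (card I)"
  have m: "m > 0" using I by (simp add: m_def card_gt_0_iff)
  have \<tau>: "\<tau> > 0" using pos m by (simp add: \<tau>_def flip: m_def)
  have exp_eq: "(\<integral>z. g t z \<partial>\<mu> i) = expectation (\<lambda>\<omega>. g t (Z i \<omega>))" if "t \<in> T" "i \<in> I" for t i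
    using that g_meas rv by (simp add: \<mu>_def integral_distr)
  have S_meas: "S t \<in> borel_measurable M" if "t \<in> T" for t
    unfolding S_def using that g_meas rv
    by (intro borel_measurable_sum borel_measurable_diff borel_measurable_const)
      (auto intro: measurable_compose)
  have "(\<integral>\<^sup>+y. ennreal (exp (MAX t\<in>T. (\<Sum>j\<in>J. 0 * v t j)
            + (\<Sum>i\<in>I. (\<integral>z. \<tau> * g t z \<partial>\<mu> i) - \<tau> * g t (y i)))) \<partial>Pi\<^sub>M I \<mu>)
      \<le> ennreal (exp ((2 * (\<tau> * D) * R * K)\<^sup>2 / 2) ^ card I * (\<Sum>j\<in>J. exp (R * 0) + exp (- (R * 0))))"
    using T J I g_meas \<psi>_meas \<psi>_bound v_bound pos \<tau> False rv i0 g_lip0 g_lip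
    by (intro nn_integral_exp_Max_process[where N = N])
      (auto simp: \<mu>_def abs_mult mult.assoc right_diff_distrib[symmetric] intro!: prob_space_distr)
  also have "exp ((2 * (\<tau> * D) * R * K)\<^sup>2 / 2) ^ card I * (\<Sum>j\<in>J. exp (R * 0) + exp (- (R * 0)))
      = 2 * card J * exp (2 * m * \<tau>\<^sup>2 * (D * R * K)\<^sup>2)"
    by (simp add: m_def exp_of_nat_mult[symmetric] power2_eq_square algebra_simps)
  also have "Pi\<^sub>M I \<mu> = distr M (\<Pi>\<^sub>M i\<in>I. N) (\<lambda>\<omega>. \<lambda>i\<in>I. Z i \<omega>)"
  proof -
    have "Pi\<^sub>M I \<mu> = (\<Pi>\<^sub>M i\<in>I. distr M N (Z i))"
      by (intro PiM_cong) (auto simp: \<mu>_def)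
    then show ?thesis
      using indep indep_vars_iff_distr_eq_PiM'[where M' = "\<lambda>_. N" and X = Z and I = I] I rv by auto
  qed
  also have "(\<integral>\<^sup>+y. ennreal (exp (MAX t\<in>T. (\<Sum>j\<in>J. 0 * v t j)
            + (\<Sum>i\<in>I. (\<integral>z. \<tau> * g t z \<partial>\<mu> i) - \<tau> * g t (y i)))) \<partial>distr M (\<Pi>\<^sub>M i\<in>I. N) (\<lambda>\<omega>. \<lambda>i\<in>I. Z i \<omega>))
      = (\<integral>\<^sup>+\<omega>. ennreal (exp (MAX t\<in>T. \<tau> * S t \<omega>)) \<partial>M)"
  proof (subst nn_integral_distr)
    show "(\<lambda>\<omega>. \<lambda>i\<in>I. Z i \<omega>) \<in> measurable M (\<Pi>\<^sub>M i\<in>I. N)"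
      using rv by (intro measurable_restrict)
    have comp: "(\<lambda>x. f (x i)) \<in> borel_measurable (\<Pi>\<^sub>M i\<in>I. N)"
      if "i \<in> I" "f \<in> borel_measurable N" for f :: "'z \<Rightarrow> real" and i
      using that by (intro measurable_compose[OF measurable_component_singleton])
    show "(\<lambda>y. ennreal (exp (MAX t\<in>T. (\<Sum>j\<in>J. 0 * v t j)
            + (\<Sum>i\<in>I. (\<integral>z. \<tau> * g t z \<partial>\<mu> i) - \<tau> * g t (y i)))))
        \<in> borel_measurable (distr M (\<Pi>\<^sub>M i\<in>I. N) (\<lambda>\<omega>. \<lambda>i\<in>I. Z i \<omega>))"
      unfolding measurable_distr_eq1 using T False
      by (intro measurable_compose[OF _ measurable_ennreal] measurable_compose[OF _ borel_measurable_exp]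
          borel_measurable_Max borel_measurable_add borel_measurable_sum borel_measurable_diff
          borel_measurable_times borel_measurable_const comp g_meas)
    have eq: "(\<Sum>j\<in>J. 0 * v t j) + (\<Sum>i\<in>I. (\<integral>z. \<tau> * g t z \<partial>\<mu> i) - \<tau> * g t ((\<lambda>i\<in>I. Z i \<omega>) i)) = \<tau> * S t \<omega>"
      if "t \<in> T" for t \<omega>
      using that by (simp add: S_def sum_distrib_left right_diff_distrib exp_eq cong: sum.cong)
    show "(\<integral>\<^sup>+\<omega>. ennreal (exp (MAX t\<in>T. (\<Sum>j\<in>J. 0 * v t j)
            + (\<Sum>i\<in>I. (\<integral>z. \<tau> * g t z \<partial>\<mu> i) - \<tau> * g t ((\<lambda>i\<in>I. Z i \<omega>) i)))) \<partial>M)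
        = (\<integral>\<^sup>+\<omega>. ennreal (exp (MAX t\<in>T. \<tau> * S t \<omega>)) \<partial>M)"
      using eq by (intro nn_integral_cong arg_cong[where f = ennreal] arg_cong[where f = exp]
          arg_cong[where f = Max] image_cong) auto
  qed
  finally have moment: "(\<integral>\<^sup>+\<omega>. ennreal (exp (MAX t\<in>T. \<tau> * S t \<omega>)) \<partial>M)
      \<le> ennreal (2 * card J * exp (2 * m * \<tau>\<^sup>2 * (D * R * K)\<^sup>2))" .
  define A where "A = {\<omega> \<in> space M. \<exists>t\<in>T. x < S t \<omega>}"
  have [measurable]: "A \<in> sets M"
  proof -
    have "A = (\<Union>t\<in>T. {\<omega> \<in> space M. x < S t \<omega>})" by (auto simp: A_def)
    also have "\<dots> \<in> sets M" using T S_meas by (intro sets.finite_UN) auto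
    finally show ?thesis .
  qed
  have Max_meas: "(\<lambda>\<omega>. ennreal (exp (MAX t\<in>T. \<tau> * S t \<omega>))) \<in> borel_measurable M"
    using T False S_meas
    by (intro measurable_compose[OF _ measurable_ennreal] measurable_compose[OF _ borel_measurable_exp]
          borel_measurable_Max borel_measurable_times borel_measurable_const)
  have "ennreal (prob A) = (\<integral>\<^sup>+\<omega>. indicator A \<omega> \<partial>M)"
    by (simp add: emeasure_eq_measure)
  also have "\<dots> \<le> (\<integral>\<^sup>+\<omega>. ennreal (exp (- (\<tau> * x))) * ennreal (exp (MAX t\<in>T. \<tau> * S t \<omega>)) \<partial>M)"
  proof (intro nn_integral_mono)
    fix \<omega> assume "\<omega> \<in> space M"
    show "indicator A \<omega> \<le> ennreal (exp (- (\<tau> * x))) * ennreal (exp (MAX t\<in>T. \<tau> * S t \<omega>))"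
    proof (cases "\<omega> \<in> A")
      case True
      then obtain t where t: "t \<in> T" "x < S t \<omega>" by (auto simp: A_def)
      have "\<tau> * x \<le> \<tau> * S t \<omega>" using t \<tau> by simp
      also have "\<dots> \<le> (MAX t\<in>T. \<tau> * S t \<omega>)" using t T by (intro Max_ge) auto
      finally have "1 \<le> exp (- (\<tau> * x)) * exp (MAX t\<in>T. \<tau> * S t \<omega>)"
        by (simp flip: exp_add)
      then show ?thesis using True by (simp flip: ennreal_mult)
    qed simp
  qed
  also have "\<dots> = ennreal (exp (- (\<tau> * x))) * (\<integral>\<^sup>+\<omega>. ennreal (exp (MAX t\<in>T. \<tau> * S t \<omega>)) \<partial>M)"
    using Max_meas by (rule nn_integral_cmult)
  also have "\<dots> \<le> ennreal (exp (- (\<tau> * x))) * ennreal (2 * card J * exp (2 * m * \<tau>\<^sup>2 * (D * R * K)\<^sup>2))"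
    by (intro mult_left_mono moment) auto
  also have "\<dots> = ennreal (2 * card J * exp (2 * m * \<tau>\<^sup>2 * (D * R * K)\<^sup>2 - \<tau> * x))"
    by (simp add: exp_diff exp_minus divide_inverse mult_ac flip: ennreal_mult)
  also have "2 * m * \<tau>\<^sup>2 * (D * R * K)\<^sup>2 - \<tau> * x = - (x\<^sup>2 / (8 * card I * (D * R * K)\<^sup>2))"
    using pos m by (simp add: \<tau>_def power2_eq_square field_simps flip: m_def)
  finally show ?thesis by (simp add: A_def S_def)
qed

text \<open>The box around \<open>B\<close> meets finitely many cells of a grid of width
  \<open>\<epsilon>\<close>, and one representative is kept per occupied cell. Choosing it with
  \<open>inv_into\<close> keeps the net inside \<open>B\<close>, where the Lipschitz bounds are
  available; the \<open>+ 1\<close> avoids a zero denominator for empty \<open>J\<close>.\<close>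

lemma finite_l1_net:
  fixes B :: "('j \<Rightarrow> real) set"
    and R \<delta> :: real
  assumes J: "finite J" and B: "\<And>v. v \<in> B \<Longrightarrow> (\<Sum>j\<in>J. \<bar>v j\<bar>) \<le> R" and "0 < \<delta>"
  obtains T where "finite T" "T \<subseteq> B" "\<And>v. v \<in> B \<Longrightarrow> \<exists>t\<in>T. (\<Sum>j\<in>J. \<bar>v j - t j\<bar>) \<le> \<delta>"
proof
  define \<epsilon> where "\<epsilon> = \<delta> / (real (card J) + 1)"
  have \<epsilon>: "\<epsilon> > 0" using \<open>0 < \<delta>\<close> by (simp add: \<epsilon>_def)
  define cell where "cell v = (\<lambda>j\<in>J. \<lfloor>v j / \<epsilon>\<rfloor>)" for v
  define T where "T = inv_into B cell ` cell ` B"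
  have "cell ` B \<subseteq> (\<Pi>\<^sub>E j\<in>J. {\<lfloor>- R / \<epsilon>\<rfloor>..\<lfloor>R / \<epsilon>\<rfloor>})"
  proof (intro image_subsetI)
    fix v assume v: "v \<in> B"
    have "- R / \<epsilon> \<le> v j / \<epsilon> \<and> v j / \<epsilon> \<le> R / \<epsilon>" if "j \<in> J" for j
    proof -
      have "\<bar>v j\<bar> \<le> (\<Sum>j\<in>J. \<bar>v j\<bar>)" using J that by (intro member_le_sum) auto
      with B[OF v] have "- R \<le> v j" "v j \<le> R" by linarith+
      then show ?thesis using \<epsilon> by (intro conjI divide_right_mono) auto
    qed
    then show "cell v \<in> (\<Pi>\<^sub>E j\<in>J. {\<lfloor>- R / \<epsilon>\<rfloor>..\<lfloor>R / \<epsilon>\<rfloor>})"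
      by (auto simp: cell_def intro!: floor_mono)
  qed
  then have "finite (cell ` B)"
    by (rule finite_subset) (auto intro: finite_PiE J)
  then show "finite T" by (simp add: T_def)
  show "T \<subseteq> B" by (auto simp: T_def inv_into_into)
  fix v assume v: "v \<in> B"
  define t where "t = inv_into B cell (cell v)"
  have "cell t = cell v" unfolding t_def by (rule f_inv_into_f[OF imageI[OF v]])
  have "\<bar>v j - t j\<bar> \<le> \<epsilon>" if "j \<in> J" for j
  proof -
    have "\<lfloor>t j / \<epsilon>\<rfloor> = \<lfloor>v j / \<epsilon>\<rfloor>"
      using fun_cong[OF \<open>cell t = cell v\<close>, of j] that by (simp add: cell_def)
    then have "\<bar>v j / \<epsilon> - t j / \<epsilon>\<bar> \<le> 1" by linarith
    then show ?thesis using \<epsilon> by (simp add: field_simps abs_if split: if_splits)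
  qed
  then have "(\<Sum>j\<in>J. \<bar>v j - t j\<bar>) \<le> card J * \<epsilon>"
    using sum_bounded_above[of J "\<lambda>j. \<bar>v j - t j\<bar>" \<epsilon>] by simp
  also have "\<dots> \<le> \<delta>" using \<open>0 < \<delta>\<close> by (simp add: \<epsilon>_def field_simps)
  finally have "(\<Sum>j\<in>J. \<bar>v j - t j\<bar>) \<le> \<delta>" .
  moreover have "t \<in> T"
  proof -
    have "cell v \<in> cell ` B" using v by (rule imageI)
    then show ?thesis unfolding T_def t_def by (rule imageI)
  qed
  ultimately show "\<exists>t\<in>T. (\<Sum>j\<in>J. \<bar>v j - t j\<bar>) \<le> \<delta>" by blast
qed

text \<open>Passage from finite index sets to arbitrary \<open>B\<close>. The level \<open>x\<close>
  is split in halves between the net and the discretization error, which turns the constant 8 into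
  32.\<close>

lemma (in prob_space) lipschitz_process_tail:
  fixes Z :: "'i \<Rightarrow> 'a \<Rightarrow> 'z" and g :: "('j \<Rightarrow> real) \<Rightarrow> 'z \<Rightarrow> real" and \<psi> :: "'j \<Rightarrow> 'z \<Rightarrow> real"
    and D K R x :: real
  assumes indep: "indep_vars (\<lambda>_. N) Z I" and I: "finite I" "I \<noteq> {}"
    and J: "finite J" "J \<noteq> {}"
    and g_meas: "\<And>v. v \<in> B \<Longrightarrow> g v \<in> borel_measurable N"
    and \<psi>_meas: "\<And>j. j \<in> J \<Longrightarrow> \<psi> j \<in> borel_measurable N"
    and \<psi>_bound: "\<And>j z. j \<in> J \<Longrightarrow> z \<in> space N \<Longrightarrow> \<bar>\<psi> j z\<bar> \<le> K"
    and v_bound: "\<And>v. v \<in> B \<Longrightarrow> (\<Sum>j\<in>J. \<bar>v j\<bar>) \<le> R"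
    and pos: "0 < D" "0 < K" "0 < R" "0 < x"
    and g_lip0: "\<And>v z. v \<in> B \<Longrightarrow> z \<in> space N \<Longrightarrow> \<bar>g v z\<bar> \<le> D * \<bar>\<Sum>j\<in>J. v j * \<psi> j z\<bar>"
    and g_lip: "\<And>v v' z. v \<in> B \<Longrightarrow> v' \<in> B \<Longrightarrow> z \<in> space N \<Longrightarrow>
        \<bar>g v z - g v' z\<bar> \<le> D * \<bar>(\<Sum>j\<in>J. v j * \<psi> j z) - (\<Sum>j\<in>J. v' j * \<psi> j z)\<bar>"
  obtains A where "A \<in> events"
    "1 - 2 * card J * exp (- (x\<^sup>2 / (32 * card I * (D * R * K)\<^sup>2))) \<le> prob A"
    "\<And>\<omega> v. \<omega> \<in> A \<Longrightarrow> v \<in> B \<Longrightarrow> (\<Sum>i\<in>I. expectation (\<lambda>\<omega>. g v (Z i \<omega>)) - g v (Z i \<omega>)) \<le> x"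
proof -
  define m where "m = real (card I)"
  have m: "m > 0" using I by (simp add: m_def card_gt_0_iff)
  \<comment> \<open>Both the value and the expectation change by at most
    \<open>D * \<delta> * K\<close> in each of the \<open>m\<close> summands; this
    \<open>\<delta>\<close> makes the total \<open>x / 2\<close>.\<close>
  define \<delta> where "\<delta> = x / (4 * m * D * K)"
  have \<delta>: "\<delta> > 0" using pos m by (simp add: \<delta>_def)
  obtain T where T: "finite T" "T \<subseteq> B" and net: "\<And>v. v \<in> B \<Longrightarrow> \<exists>t\<in>T. (\<Sum>j\<in>J. \<bar>v j - t j\<bar>) \<le> \<delta>"
    using finite_l1_net[of J B R \<delta>] J(1) v_bound \<delta> by blast
  have rv: "Z i \<in> measurable M N" if "i \<in> I" for i
    using indep that by (simp add: indep_vars_def)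
  define S where "S v \<omega> = (\<Sum>i\<in>I. expectation (\<lambda>\<omega>. g v (Z i \<omega>)) - g v (Z i \<omega>))" for v \<omega>
  have S_meas: "S v \<in> borel_measurable M" if "v \<in> B" for v
    unfolding S_def using that g_meas rv
    by (intro borel_measurable_sum borel_measurable_diff borel_measurable_const)
      (auto intro: measurable_compose)
  \<comment> \<open>Only points of the finite net enter the event, so it is measurable although
    \<open>B\<close> may be uncountable.\<close>
  define A where "A = {\<omega> \<in> space M. \<forall>t\<in>T. S t \<omega> \<le> x / 2}"
  have bad: "space M - A = {\<omega> \<in> space M. \<exists>t\<in>T. x / 2 < S t \<omega>}"
    by (auto simp: A_def not_le)
  have "A = space M - (\<Union>t\<in>T. {\<omega> \<in> space M. x / 2 < S t \<omega>})"
    by (auto simp: A_def not_le not_less)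
  also have "\<dots> \<in> events" using T S_meas by (intro sets.Diff sets.top sets.finite_UN) auto
  finally have A: "A \<in> events" .
  have "prob (space M - A) \<le> 2 * card J * exp (- ((x / 2)\<^sup>2 / (8 * card I * (D * R * K)\<^sup>2)))"
    unfolding bad S_def using pos T
    by (intro finite_lipschitz_process_tail[OF indep I _ J, where \<psi> = \<psi> and v = "\<lambda>v. v"] g_meas \<psi>_meas \<psi>_bound v_bound g_lip0 g_lip)
      auto
  then have prob: "1 - 2 * card J * exp (- (x\<^sup>2 / (32 * card I * (D * R * K)\<^sup>2))) \<le> prob A"
    using prob_compl[OF A] by (simp add: power_divide mult.assoc)
  have lip: "\<bar>g v z - g t z\<bar> \<le> D * (\<delta> * K)" if "v \<in> B" "t \<in> B" "(\<Sum>j\<in>J. \<bar>v j - t j\<bar>) \<le> \<delta>" "z \<in> space N" for v t z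
  proof -
    have "\<bar>(\<Sum>j\<in>J. v j * \<psi> j z) - (\<Sum>j\<in>J. t j * \<psi> j z)\<bar> = \<bar>\<Sum>j\<in>J. (v j - t j) * \<psi> j z\<bar>"
      by (simp add: sum_subtractf left_diff_distrib)
    also have "\<dots> \<le> (\<Sum>j\<in>J. \<bar>v j - t j\<bar> * K)"
      using \<psi>_bound that by (auto simp: abs_mult intro!: sum_abs[THEN order_trans] sum_mono mult_left_mono)
    also have "\<dots> \<le> \<delta> * K"
      using that pos by (simp add: mult_right_mono flip: sum_distrib_right)
    finally show ?thesis
      using pos by (intro order_trans[OF g_lip[OF that(1,2,4)] mult_left_mono]) auto
  qed
  have int: "integrable M (\<lambda>\<omega>. g v (Z i \<omega>))" if "v \<in> B" "i \<in> I" for v i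
  proof (rule integrable_const_bound[where B = "D * (R * K)"])
    show "AE \<omega> in M. norm (g v (Z i \<omega>)) \<le> D * (R * K)"
    proof (rule AE_I2)
      fix \<omega> assume "\<omega> \<in> space M"
      then have z: "Z i \<omega> \<in> space N" using rv[OF that(2)] by (auto dest: measurable_space)
      have "\<bar>\<Sum>j\<in>J. v j * \<psi> j (Z i \<omega>)\<bar> \<le> (\<Sum>j\<in>J. \<bar>v j\<bar> * K)"
        using \<psi>_bound z by (auto simp: abs_mult intro!: sum_abs[THEN order_trans] sum_mono mult_left_mono)
      also have "\<dots> \<le> R * K"
        using v_bound that pos by (simp add: mult_right_mono flip: sum_distrib_right)
      finally show "norm (g v (Z i \<omega>)) \<le> D * (R * K)"
        using pos by (simp add: order_trans[OF g_lip0[OF that(1) z] mult_left_mono])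
    qed
    show "(\<lambda>\<omega>. g v (Z i \<omega>)) \<in> borel_measurable M"
      using rv[OF that(2)] g_meas[OF that(1)] by (rule measurable_compose)
  qed
  have "S v \<omega> \<le> x" if \<omega>: "\<omega> \<in> A" and v: "v \<in> B" for v \<omega>
  proof -
    obtain t where t: "t \<in> T" "(\<Sum>j\<in>J. \<bar>v j - t j\<bar>) \<le> \<delta>" using net[OF v] by auto
    have tB: "t \<in> B" using t T by auto
    have "(expectation (\<lambda>\<omega>. g v (Z i \<omega>)) - g v (Z i \<omega>)) \<le> (expectation (\<lambda>\<omega>. g t (Z i \<omega>)) - g t (Z i \<omega>)) + 2 * (D * (\<delta> * K))"
      if i: "i \<in> I" for i
    proof -
      have z: "Z i \<omega> \<in> space N" if "\<omega> \<in> space M" for \<omega> using rv[OF i] that by (auto dest: measurable_space)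
      have "g v (Z i \<omega>) \<le> g t (Z i \<omega>) + D * (\<delta> * K)" if "\<omega> \<in> space M" for \<omega>
        using lip[OF v tB t(2) z[OF that]] by linarith
      then have "expectation (\<lambda>\<omega>. g v (Z i \<omega>)) \<le> expectation (\<lambda>\<omega>. g t (Z i \<omega>) + D * (\<delta> * K))"
        using int[OF v i] int[OF tB i] by (intro integral_mono) auto
      then have "expectation (\<lambda>\<omega>. g v (Z i \<omega>)) \<le> expectation (\<lambda>\<omega>. g t (Z i \<omega>)) + D * (\<delta> * K)"
        using int[OF tB i] by (simp add: prob_space)
      moreover have "\<omega> \<in> space M" using \<omega> by (simp add: A_def)
      ultimately show ?thesis using lip[OF v tB t(2) z[of \<omega>]] by linarith
    qed
    then have "S v \<omega> \<le> (\<Sum>i\<in>I. (expectation (\<lambda>\<omega>. g t (Z i \<omega>)) - g t (Z i \<omega>)) + 2 * (D * (\<delta> * K)))"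
      unfolding S_def by (rule sum_mono)
    also have "\<dots> = S t \<omega> + m * (2 * (D * (\<delta> * K)))"
      by (simp add: S_def sum.distrib m_def)
    also have "m * (2 * (D * (\<delta> * K))) = x / 2"
      using pos m by (simp add: \<delta>_def field_simps)
    also have "S t \<omega> \<le> x / 2" using \<omega> t by (simp add: A_def)
    finally show ?thesis by simp
  qed
  then show ?thesis using that A prob unfolding S_def by blast
qed

section \<open>The oracle inequality\<close>

lemma sum_abs_le_sqrt_card_L2_set:
  "(\<Sum>j\<in>S. \<bar>f j\<bar>) \<le> sqrt (card S) * L2_set f S"
  using L2_set_mult_ineq[of f "\<lambda>_. 1" S] by (simp add: L2_set_constant mult.commute)

lemma l1norm_restr: "S \<subseteq> {1..p} \<Longrightarrow> l1norm p (restr \<beta> S) = (\<Sum>j\<in>S. \<bar>\<beta> j\<bar>)"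
  unfolding l1norm_def restr_def by (simp add: if_distrib sum.inter_restrict[symmetric] Int_absorb1 cong: if_cong)

lemma l2norm_restr: "S \<subseteq> {1..p} \<Longrightarrow> l2norm p (restr \<beta> S) = L2_set \<beta> S"
  unfolding l2norm_def L2_set_def restr_def
  by (simp add: if_distribR if_distrib[of "\<lambda>x. x\<^sup>2"] sum.inter_restrict[symmetric] Int_absorb1 cong: if_cong)

lemma lin_diff: "lin Q (\<lambda>j. \<beta> j - \<beta>' j) = (\<lambda>x. lin Q \<beta> x - lin Q \<beta>' x)"
  by (simp add: lin_def left_diff_distrib sum_subtractf)

lemma lin_convex_comb: "lin Q (\<lambda>j. t * \<beta> j + (1 - t) * \<beta>' j) = (\<lambda>x. t * lin Q \<beta> x + (1 - t) * lin Q \<beta>' x)"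
  by (simp add: lin_def distrib_right sum.distrib sum_distrib_left mult.assoc)

section \<open>The problem for one fixed sample size\<close>

text \<open>Here \<open>b\<close> has the role of the oracle vector, and membership in
  \<open>Phi Q\<close> makes it a competitor of the estimator. \<open>lam0\<close> is any positive
  number; it is tied to \<open>ln p / n\<close> only in \<open>corollary1\<close>.\<close>

locale oracle_setting =
  fixes n :: nat and Q :: "('w, 'x) problem" and G :: "real \<Rightarrow> real" and b :: "nat \<Rightarrow> real"
    and K D lam0 :: real and \<gamma> :: "real \<Rightarrow> real \<Rightarrow> real" and c :: "('x \<Rightarrow> real) \<Rightarrow> real"
  assumes n: "n \<ge> 1" and setting: "setting n Q" and b_Phi: "b \<in> Phi Q"
    and pos: "0 < K" "0 < D" "0 < lam0" and G0: "G 0 = 0"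
    and loss_eq: "\<And>f x y. f \<in> Fsp Q \<Longrightarrow> x \<in> XS Q \<Longrightarrow> y \<in> YS Q \<Longrightarrow> loss Q f (x, y) = \<gamma> y (f x) + c f"
    and loss_lipschitz: "\<And>x y \<beta> \<beta>'. x \<in> XS Q \<Longrightarrow> y \<in> YS Q \<Longrightarrow> \<beta> \<in> Phi Q \<Longrightarrow> \<beta>' \<in> Phi Q \<Longrightarrow>
        \<bar>\<gamma> y (lin Q \<beta> x) - \<gamma> y (lin Q \<beta>' x)\<bar> \<le> D * \<bar>lin Q \<beta> x - lin Q \<beta>' x\<bar>"
    and psi_bound: "\<And>j x. j \<in> {1..dimp Q} \<Longrightarrow> x \<in> XS Q \<Longrightarrow> \<bar>psi Q j x\<bar> \<le> K"
    and lam1: "8 * lam0 \<le> lam1 Q"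
    and lam2: "lam2 Q = lam1 Q * sqrt (real (card (supp (dimp Q) b))) / (2 * l2norm (dimp Q) b)"
    and margin: "\<And>f. f \<in> F_local Q \<Longrightarrow> G (Fnorm Q (\<lambda>x. f x - target Q x)) \<le> excess n Q f"
    and local_b: "lin Q b \<in> F_local Q"
    and local_ball: "\<And>\<beta>. \<beta> \<in> Rvec (dimp Q) \<Longrightarrow>
        ereal (l1norm (dimp Q) (\<lambda>j. \<beta> j - b j)) \<le> M_star n G Q b lam0 \<Longrightarrow> lin Q \<beta> \<in> F_local Q"
    and eig_pos: "0 < restr_eig Q b"
begin

abbreviation "p \<equiv> dimp Q"
abbreviation "S \<equiv> supp p b"
abbreviation "f0 \<equiv> target Q"
abbreviation "risk_gap \<beta> \<equiv> excess n Q (lin Q \<beta>)"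
abbreviation "dist_f0 f \<equiv> Fnorm Q (\<lambda>x. f x - f0 x)"
abbreviation "objective \<omega> \<beta> \<equiv> emp_risk n Q \<omega> (lin Q \<beta>) + lam1 Q * l1norm p \<beta> + lam2 Q * (l2norm p \<beta>)\<^sup>2"

text \<open>The argument of the conjugate in the oracle objective at \<open>b\<close>: the choice of
  \<open>lam2\<close> makes the ridge part \<open>4 * lam2 Q * l2norm p b\<close> equal to
  \<open>2 * lam1 Q * sqrt (card S)\<close>.\<close>

definition "slope = 6 * lam1 Q * sqrt (card S) / restr_eig Q b"

lemma prob_space_\<Omega>: "prob_space (\<Omega>P Q)"
  and indep_obs: "prob_space.indep_vars (\<Omega>P Q) (\<lambda>_. ZM Q) (obs Q) {1..n}"
  and fun_space: "normed_function_space (XS Q) (Fsp Q) (Fnorm Q)"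
  and loss_meas: "f \<in> Fsp Q \<Longrightarrow> loss Q f \<in> borel_measurable (ZM Q)"
  and loss_integrable: "f \<in> Fsp Q \<Longrightarrow> i \<in> {1..n} \<Longrightarrow> integrable (\<Omega>P Q) (\<lambda>\<omega>. loss Q f (obs Q i \<omega>))"
  and loss_convex: "f \<in> Fsp Q \<Longrightarrow> f' \<in> Fsp Q \<Longrightarrow> z \<in> XS Q \<times> YS Q \<Longrightarrow> 0 \<le> t \<Longrightarrow> t \<le> 1 \<Longrightarrow>
        loss Q (\<lambda>x. t * f x + (1 - t) * f' x) z \<le> t * loss Q f z + (1 - t) * loss Q f' z"
  and f0_min: "is_arg_min (risk n Q) (\<lambda>f. f \<in> Fsp Q) f0"
  and f0_unique: "is_arg_min (risk n Q) (\<lambda>f. f \<in> Fsp Q) f \<Longrightarrow> f = f0"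
  and psi_in: "j \<in> {1..p} \<Longrightarrow> psi Q j \<in> Fsp Q"
  and psi_meas: "j \<in> {1..p} \<Longrightarrow> psi Q j \<in> borel_measurable (XM Q)"
  and Phi_sub: "Phi Q \<subseteq> Rvec p" and Phi_convex: "convex_vecs (Phi Q)"
  and lam_pos: "0 < lam1 Q" "0 < lam2 Q" and eta_pos: "0 < eta Q"
  using setting unfolding setting_def by auto

lemma b_Rvec: "b \<in> Rvec p"
  using b_Phi Phi_sub by blast

lemma S_sub: "S \<subseteq> {1..p}" and S_finite: "finite S"
  by (auto simp: supp_def)

lemma b_zero: "j \<notin> S \<Longrightarrow> b j = 0"
  using b_Rvec by (auto simp: supp_def Rvec_def)

lemma Fsp_vanish: "f \<in> Fsp Q \<Longrightarrow> x \<notin> XS Q \<Longrightarrow> f x = 0"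
  and Fsp_zero: "(\<lambda>_. 0) \<in> Fsp Q"
  and Fsp_add: "f \<in> Fsp Q \<Longrightarrow> f' \<in> Fsp Q \<Longrightarrow> (\<lambda>x. f x + f' x) \<in> Fsp Q"
  and Fsp_scale: "f \<in> Fsp Q \<Longrightarrow> (\<lambda>x. a * f x) \<in> Fsp Q"
  and Fnorm_nonneg: "f \<in> Fsp Q \<Longrightarrow> 0 \<le> Fnorm Q f"
  and Fnorm_zero: "f \<in> Fsp Q \<Longrightarrow> Fnorm Q f = 0 \<longleftrightarrow> f = (\<lambda>_. 0)"
  and Fnorm_triangle: "f \<in> Fsp Q \<Longrightarrow> f' \<in> Fsp Q \<Longrightarrow> Fnorm Q (\<lambda>x. f x + f' x) \<le> Fnorm Q f + Fnorm Q f'"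
  and Fnorm_scale: "f \<in> Fsp Q \<Longrightarrow> Fnorm Q (\<lambda>x. a * f x) = \<bar>a\<bar> * Fnorm Q f"
  using fun_space unfolding normed_function_space_def by blast+

lemma Fsp_diff: "f \<in> Fsp Q \<Longrightarrow> f' \<in> Fsp Q \<Longrightarrow> (\<lambda>x. f x - f' x) \<in> Fsp Q"
  using Fsp_add[OF _ Fsp_scale[of f' "- 1"], of f] by simp

lemma Fnorm_diff_triangle:
  assumes "f \<in> Fsp Q" "f' \<in> Fsp Q" "h \<in> Fsp Q"
  shows "Fnorm Q (\<lambda>x. f x - f' x) \<le> Fnorm Q (\<lambda>x. f x - h x) + Fnorm Q (\<lambda>x. f' x - h x)"
proof -
  have "Fnorm Q (\<lambda>x. (f x - h x) + - 1 * (f' x - h x))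
      \<le> Fnorm Q (\<lambda>x. f x - h x) + Fnorm Q (\<lambda>x. - 1 * (f' x - h x))"
    using assms by (intro Fnorm_triangle Fsp_scale Fsp_diff)
  also have "Fnorm Q (\<lambda>x. - 1 * (f' x - h x)) = Fnorm Q (\<lambda>x. f' x - h x)"
    using Fnorm_scale[OF Fsp_diff[OF assms(2,3)], of "- 1"] by simp
  finally show ?thesis by (simp add: algebra_simps)
qed

lemma lin_in: "lin Q \<beta> \<in> Fsp Q"
proof -
  have "(\<lambda>x. \<Sum>j\<in>A. \<beta> j * psi Q j x) \<in> Fsp Q" if "finite A" "A \<subseteq> {1..p}" for A
    using that by (induction A) (auto intro!: Fsp_zero Fsp_add Fsp_scale psi_in)
  then show ?thesis by (simp add: lin_def)
qed

lemma f0_in: "f0 \<in> Fsp Q"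
  using f0_min by (simp add: is_arg_min_def)

lemma excess_nonneg: "f \<in> Fsp Q \<Longrightarrow> 0 \<le> excess n Q f"
  using f0_min by (auto simp: is_arg_min_def excess_def not_less)

lemma excess_eq_0: "f \<in> Fsp Q \<Longrightarrow> excess n Q f = 0 \<Longrightarrow> f = f0"
  using f0_min by (intro f0_unique) (auto simp: is_arg_min_def excess_def)

text \<open>Division by zero gives 0, so the formula for \<open>lam2 Q\<close> would yield 0 if
  \<open>b\<close> vanished or had empty support. Positivity of \<open>lam2 Q\<close> excludes
  both.\<close>

lemma l2norm_b_pos: "0 < l2norm p b" and card_S_pos: "0 < card S"
proof -
  have "l2norm p b \<noteq> 0" using lam_pos(2) by (auto simp: lam2)
  then show "0 < l2norm p b" by (simp add: l2norm_def order_less_le del: L2_set_eq_0_iff)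
  show "0 < card S"
  proof (rule gr0I)
    assume "card S = 0"
    then have "lam2 Q = 0" unfolding lam2 by (simp only: of_nat_0 real_sqrt_zero mult_zero_right div_0)
    then show False using lam_pos by simp
  qed
qed

lemma lam2_eq: "2 * lam2 Q * l2norm p b = lam1 Q * sqrt (card S)"
  using l2norm_b_pos by (simp add: lam2)

lemma slope_pos: "0 < slope"
  using lam_pos card_S_pos eig_pos by (simp add: slope_def)

lemma L2_set_b: "L2_set b S = l2norm p b"
proof -
  have "(\<Sum>j\<in>S. (b j)\<^sup>2) = (\<Sum>j=1..p. (b j)\<^sup>2)"
    using S_sub b_zero by (intro sum.mono_neutral_left) auto
  then show ?thesis by (simp add: l2norm_def L2_set_def)
qed

lemma cone_const_eq: "cone_const Q b = 6 * sqrt (card S)"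
proof -
  have "2 * lam2 Q * l2norm p b / lam1 Q = sqrt (card S)"
    unfolding lam2_eq using lam_pos by simp
  then show ?thesis using S_sub by (simp add: cone_const_def Let_def l2norm_restr L2_set_b)
qed

lemma penalty_arg_eq: "penalty_arg Q b = ereal slope"
proof -
  have "4 * lam1 Q * sqrt (card S) + 4 * lam2 Q * l2norm p b = 6 * lam1 Q * sqrt (card S)"
    using lam2_eq by simp
  then show ?thesis using eig_pos unfolding penalty_arg_def slope_def by simp
qed

text \<open>The infimum in multiplied-out form, which also covers a vector vanishing on
  \<open>S\<close>, where the quotient has no meaning.\<close>

lemma restr_eig_le:
  assumes \<delta>: "\<delta> \<in> Rvec p" and cone: "(\<Sum>j\<in>{1..p} - S. \<bar>\<delta> j\<bar>) \<le> 6 * sqrt (card S) * L2_set \<delta> S"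
  shows "restr_eig Q b * L2_set \<delta> S \<le> Fnorm Q (lin Q \<delta>)"
proof (cases "L2_set \<delta> S = 0")
  case True
  then show ?thesis using Fnorm_nonneg[OF lin_in] by simp
next
  case False
  then have \<delta>S: "0 < L2_set \<delta> S" by (simp add: order_less_le del: L2_set_eq_0_iff)
  have "\<delta> \<noteq> (\<lambda>_. 0)" using False by (auto simp: L2_set_def)
  have "restr_eig_sq Q b \<le> (Fnorm Q (lin Q \<delta>))\<^sup>2 / (L2_set \<delta> S)\<^sup>2"
    unfolding restr_eig_sq_def Let_def
  proof (rule cInf_lower)
    show "bdd_below {(Fnorm Q (lin Q \<beta>))\<^sup>2 / (l2norm p (restr \<beta> S))\<^sup>2 |\<beta>. \<beta> \<in> Rvec p - {\<lambda>_. 0} \<and>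
        l1norm p (restr \<beta> ({1..p} - S)) \<le> cone_const Q b * l2norm p (restr \<beta> S)}"
      by (rule bdd_belowI[where m = 0]) auto
    show "(Fnorm Q (lin Q \<delta>))\<^sup>2 / (L2_set \<delta> S)\<^sup>2
        \<in> {(Fnorm Q (lin Q \<beta>))\<^sup>2 / (l2norm p (restr \<beta> S))\<^sup>2 |\<beta>. \<beta> \<in> Rvec p - {\<lambda>_. 0} \<and>
        l1norm p (restr \<beta> ({1..p} - S)) \<le> cone_const Q b * l2norm p (restr \<beta> S)}"
      using \<delta> cone \<open>\<delta> \<noteq> (\<lambda>_. 0)\<close> S_sub
      by (intro CollectI exI[of _ \<delta>]) (simp add: l1norm_restr l2norm_restr cone_const_eq)
  qed
  then have "restr_eig Q b \<le> sqrt ((Fnorm Q (lin Q \<delta>) / L2_set \<delta> S)\<^sup>2)"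
    unfolding restr_eig_def by (simp add: power_divide)
  also have "\<dots> = Fnorm Q (lin Q \<delta>) / L2_set \<delta> S"
    using Fnorm_nonneg[OF lin_in] \<delta>S by simp
  finally show ?thesis using \<delta>S by (simp add: field_simps)
qed

section \<open>The conjugate at the oracle and the local radius\<close>

lemma conv_conj_ge: "ereal (u * v - G u) \<le> conv_conj G (ereal v)" if "0 \<le> u"
  unfolding conv_conj_def using that by (intro SUP_upper2[of u]) auto

text \<open>An infinite conjugate would give \<open>M_star = \<infinity>\<close>, hence \<open>psi Q j = (\<lambda>_. 0)\<close> for all \<open>j\<close>,
  against \<open>restr_eig Q b > 0\<close>.\<close>
lemma conv_conj_finite: "conv_conj G (ereal slope) \<noteq> \<infinity>"
proof
  assume inf: "conv_conj G (ereal slope) = \<infinity>"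
  \<comment> \<open>The ball of infinite radius is all of \<open>Rvec p\<close>, so even arbitrarily
    large multiples of one dictionary function would have to stay local.\<close>
  have "M_star n G Q b lam0 = \<infinity>"
    using pos by (simp add: M_star_def oracle_obj_def penalty_arg_eq inf)
  then have all_local: "lin Q \<beta> \<in> F_local Q" if "\<beta> \<in> Rvec p" for \<beta>
    using local_ball that by simp
  obtain j where j: "j \<in> S" using card_S_pos by (metis card.empty ex_in_conv less_irrefl)
  then have jp: "j \<in> {1..p}" using S_sub by blast
  define e where "e t i = (if i = j then t else (0 :: real))" for t i
  have e_Rvec: "e t \<in> Rvec p" for t using jp by (auto simp: e_def Rvec_def)
  have lin_e: "lin Q (e t) = (\<lambda>x. t * psi Q j x)" for t
  proof
    fix x
    have "lin Q (e t) x = (\<Sum>i=1..p. if i = j then t * psi Q j x else 0)"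
      unfolding lin_def by (intro sum.cong) (auto simp: e_def)
    then show "lin Q (e t) x = t * psi Q j x" using jp by simp
  qed
  have L2: "L2_set (e 1) S = 1"
  proof -
    have "(\<Sum>i\<in>S. (e 1 i)\<^sup>2) = (\<Sum>i\<in>S. if i = j then 1 else 0)"
      by (intro sum.cong) (auto simp: e_def)
    then show ?thesis using j S_finite by (simp add: L2_set_def)
  qed
  have "(\<Sum>i\<in>{1..p} - S. \<bar>e 1 i\<bar>) = 0" using j by (auto simp: e_def)
  then have "restr_eig Q b \<le> Fnorm Q (lin Q (e 1))"
    using restr_eig_le[OF e_Rvec, of 1] by (simp add: L2)
  then have "psi Q j \<noteq> (\<lambda>_. 0)"
    using eig_pos Fnorm_zero[OF Fsp_zero] unfolding lin_e by auto
  then obtain x where x: "psi Q j x \<noteq> 0" by auto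
  then have "x \<in> XS Q" using Fsp_vanish[OF psi_in[OF jp]] by blast
  \<comment> \<open>Scaled so that \<open>\<bar>t * psi Q j x\<bar>\<close> exceeds
    \<open>\<bar>f0 x\<bar> + eta Q\<close> by 1, which breaks locality at \<open>x\<close>.\<close>
  define t where "t = (\<bar>f0 x\<bar> + eta Q + 1) / \<bar>psi Q j x\<bar>"
  have "supnorm_on (XS Q) (\<lambda>y. lin Q (e t) y - f0 y) \<le> ereal (eta Q)"
    using all_local[OF e_Rvec] by (simp add: F_local_def)
  then have "ereal \<bar>t * psi Q j x - f0 x\<bar> \<le> ereal (eta Q)"
    unfolding supnorm_on_def SUP_le_iff lin_e using \<open>x \<in> XS Q\<close> by blast
  moreover have "\<bar>t * psi Q j x\<bar> = \<bar>f0 x\<bar> + eta Q + 1"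
    using x eta_pos by (simp add: t_def abs_mult)
  ultimately show False by simp
qed

definition "conj_slope = real_of_ereal (conv_conj G (ereal slope))"

lemma conv_conj_slope: "conv_conj G (ereal slope) = ereal conj_slope"
  and conj_slope_nonneg: "0 \<le> conj_slope"
proof -
  have "0 \<le> conv_conj G (ereal slope)" using conv_conj_ge[of 0 slope] G0 by (simp add: zero_ereal_def)
  then show "conv_conj G (ereal slope) = ereal conj_slope" "0 \<le> conj_slope"
    using conv_conj_finite unfolding conj_slope_def
    by (cases "conv_conj G (ereal slope)"; simp)+
qed

lemma fenchel: "0 \<le> u \<Longrightarrow> slope * u \<le> G u + conj_slope"
  using conv_conj_ge[of u slope] by (simp add: conv_conj_slope mult.commute)

lemma M_star_eq: "M_star n G Q b lam0 = ereal ((3 / 2 * risk_gap b + conj_slope) / lam0)"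
  using pos by (simp add: M_star_def oracle_obj_def penalty_arg_eq conv_conj_slope field_simps)

lemma lin_bound:
  assumes "x \<in> XS Q" shows "\<bar>lin Q \<delta> x\<bar> \<le> l1norm p \<delta> * K"
proof -
  have "\<bar>lin Q \<delta> x\<bar> \<le> (\<Sum>j=1..p. \<bar>\<delta> j\<bar> * K)"
    unfolding lin_def using psi_bound assms
    by (auto simp: abs_mult intro!: sum_abs[THEN order_trans] sum_mono mult_left_mono)
  then show ?thesis by (simp add: l1norm_def sum_distrib_right)
qed

text \<open>If the radius \<open>M_star\<close> is \<open>0\<close> then \<open>lin Q b\<close> is the target, and locality of a
  small ball around \<open>b\<close> comes from \<open>eta Q > 0\<close> instead.\<close>
lemma local_radius:
  assumes "0 < e"
  obtains R where "0 < R" "3 / 2 * risk_gap b + min conj_slope e \<le> lam0 * R"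
    "lam0 * R \<le> 3 / 2 * risk_gap b + e"
    "\<And>\<beta>. \<beta> \<in> Rvec p \<Longrightarrow> l1norm p (\<lambda>j. \<beta> j - b j) \<le> R \<Longrightarrow> lin Q \<beta> \<in> F_local Q"
proof (cases "0 < 3 / 2 * risk_gap b + min conj_slope e")
  case True
  show ?thesis
  proof
    let ?R = "(3 / 2 * risk_gap b + min conj_slope e) / lam0"
    show "0 < ?R" using True pos by simp
    show "3 / 2 * risk_gap b + min conj_slope e \<le> lam0 * ?R" using pos by simp
    show "lam0 * ?R \<le> 3 / 2 * risk_gap b + e" using pos by simp
    show "lin Q \<beta> \<in> F_local Q" if "\<beta> \<in> Rvec p" "l1norm p (\<lambda>j. \<beta> j - b j) \<le> ?R" for \<beta>
    proof (rule local_ball[OF that(1)])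
      have "?R \<le> (3 / 2 * risk_gap b + conj_slope) / lam0"
        using pos by (intro divide_right_mono) auto
      with that(2) show "ereal (l1norm p (\<lambda>j. \<beta> j - b j)) \<le> M_star n G Q b lam0"
        unfolding M_star_eq by simp
    qed
  qed
next
  case False
  \<comment> \<open>Both terms are nonnegative and \<open>e\<close> is positive, so a nonpositive
    sum forces the excess risk and the conjugate to vanish.\<close>
  have zero: "risk_gap b = 0" "conj_slope = 0"
    using False excess_nonneg[OF lin_in, of b] conj_slope_nonneg assms by (auto simp: min_def split: if_splits)
  then have "lin Q b = f0" by (intro excess_eq_0 lin_in)
  show ?thesis
  proof
    \<comment> \<open>The first entry keeps the sup-distance to the target below
      \<open>eta Q\<close>, since the dictionary is bounded by \<open>K\<close>; the second gives
      \<open>lam0 * R \<le> e\<close>.\<close>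
    let ?R = "min (eta Q / K) (e / lam0)"
    show "0 < ?R" using assms pos eta_pos by simp
    then show "3 / 2 * risk_gap b + min conj_slope e \<le> lam0 * ?R" using zero assms pos by simp
    have "lam0 * ?R \<le> lam0 * (e / lam0)" using pos by (intro mult_left_mono) auto
    then show "lam0 * ?R \<le> 3 / 2 * risk_gap b + e" using zero pos by simp
    show "lin Q \<beta> \<in> F_local Q" if "\<beta> \<in> Rvec p" "l1norm p (\<lambda>j. \<beta> j - b j) \<le> ?R" for \<beta>
    proof -
      have "\<bar>lin Q \<beta> x - f0 x\<bar> \<le> eta Q" if "x \<in> XS Q" for x
      proof -
        have "\<bar>lin Q \<beta> x - f0 x\<bar> \<le> l1norm p (\<lambda>j. \<beta> j - b j) * K"
          using lin_bound[OF that, of "\<lambda>j. \<beta> j - b j"] \<open>lin Q b = f0\<close> by (simp add: lin_diff)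
        also have "\<dots> \<le> eta Q / K * K"
          using \<open>l1norm p _ \<le> ?R\<close> pos by (intro mult_right_mono) auto
        finally show ?thesis using pos by simp
      qed
      then show ?thesis
        unfolding F_local_def supnorm_on_def by (auto intro!: SUP_least lin_in)
    qed
  qed
qed

section \<open>Deterministic inequalities given the noise bound\<close>

lemma l1norm_split: "l1norm p \<beta> = (\<Sum>j\<in>S. \<bar>\<beta> j\<bar>) + (\<Sum>j\<in>{1..p} - S. \<bar>\<beta> j\<bar>)"
  unfolding l1norm_def using S_sub by (simp add: sum.subset_diff add.commute)

text \<open>Triangle inequality on \<open>S\<close>. Off \<open>S\<close> the vector
  \<open>b\<close> is zero, so the l1-norm of \<open>\<beta>\<close> there equals that of the
  difference and enters with a negative sign.\<close>

lemma l1norm_decrease: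
  "l1norm p b - l1norm p \<beta> \<le> (\<Sum>j\<in>S. \<bar>\<beta> j - b j\<bar>) - (\<Sum>j\<in>{1..p} - S. \<bar>\<beta> j - b j\<bar>)"
proof -
  have "(\<Sum>j\<in>S. \<bar>b j\<bar>) \<le> (\<Sum>j\<in>S. \<bar>\<beta> j - b j\<bar> + \<bar>\<beta> j\<bar>)" by (intro sum_mono) auto
  moreover have "(\<Sum>j\<in>{1..p} - S. \<bar>b j\<bar>) = 0" using b_zero by simp
  moreover have "(\<Sum>j\<in>{1..p} - S. \<bar>\<beta> j - b j\<bar>) = (\<Sum>j\<in>{1..p} - S. \<bar>\<beta> j\<bar>)" using b_zero by simp
  ultimately show ?thesis unfolding l1norm_split sum.distrib by simp
qed

text \<open>Expanding around \<open>b\<close> leaves a linear term and a negative square, which is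
  dropped. As \<open>b\<close> vanishes off \<open>S\<close>, Cauchy-Schwarz is needed on
  \<open>S\<close> only.\<close>

lemma l2norm_decrease:
  "(l2norm p b)\<^sup>2 - (l2norm p \<beta>)\<^sup>2 \<le> 2 * l2norm p b * L2_set (\<lambda>j. \<beta> j - b j) S"
proof -
  have "(l2norm p b)\<^sup>2 - (l2norm p \<beta>)\<^sup>2 = (\<Sum>j=1..p. (b j)\<^sup>2 - (\<beta> j)\<^sup>2)"
    by (simp add: l2norm_def L2_set_def sum_nonneg sum_subtractf)
  also have "\<dots> \<le> (\<Sum>j=1..p. 2 * (\<bar>b j\<bar> * \<bar>\<beta> j - b j\<bar>))"
  proof (intro sum_mono)
    fix j
    have "(b j)\<^sup>2 - (\<beta> j)\<^sup>2 = - 2 * (b j * (\<beta> j - b j)) - (\<beta> j - b j)\<^sup>2"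
      by (simp add: power2_eq_square algebra_simps)
    also have "\<dots> \<le> 2 * \<bar>b j * (\<beta> j - b j)\<bar>"
      using abs_ge_minus_self[of "b j * (\<beta> j - b j)"] zero_le_power2[of "\<beta> j - b j"] by linarith
    finally show "(b j)\<^sup>2 - (\<beta> j)\<^sup>2 \<le> 2 * (\<bar>b j\<bar> * \<bar>\<beta> j - b j\<bar>)" by (simp add: abs_mult)
  qed
  also have "\<dots> = 2 * (\<Sum>j\<in>S. \<bar>b j\<bar> * \<bar>\<beta> j - b j\<bar>)"
    unfolding sum_distrib_left using S_sub b_zero by (intro sum.mono_neutral_right) auto
  also have "\<dots> \<le> 2 * (L2_set b S * L2_set (\<lambda>j. \<beta> j - b j) S)"
    by (intro mult_left_mono L2_set_mult_ineq) auto
  finally show ?thesis by (simp add: L2_set_b)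
qed

text \<open>The factor 3 has three sources: the decrease of the l1-norm on \<open>S\<close>, the
  \<open>S\<close>-part added to complete the l1-norm on the left, and the ridge term, which the
  choice of \<open>lam2\<close> makes equally large.\<close>

lemma basic_inequality:
  assumes noise: "(risk n Q (lin Q \<beta>) - risk n Q (lin Q b))
      - (emp_risk n Q \<omega> (lin Q \<beta>) - emp_risk n Q \<omega> (lin Q b)) \<le> lam0 * R"
    and obj: "objective \<omega> \<beta> \<le> objective \<omega> b"
  shows "risk_gap \<beta> + lam1 Q * l1norm p (\<lambda>j. \<beta> j - b j)
    \<le> risk_gap b + 3 * (lam1 Q * sqrt (card S) * L2_set (\<lambda>j. \<beta> j - b j) S) + lam0 * R"
proof -
  let ?\<delta> = "\<lambda>j. \<beta> j - b j"
  let ?q = "lam1 Q * sqrt (card S) * L2_set ?\<delta> S"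
  have S1: "lam1 Q * (\<Sum>j\<in>S. \<bar>?\<delta> j\<bar>) \<le> ?q"
    using sum_abs_le_sqrt_card_L2_set[of ?\<delta> S] lam_pos by (simp add: mult.assoc)
  have l1: "lam1 Q * (l1norm p b - l1norm p \<beta>)
      \<le> lam1 Q * (\<Sum>j\<in>S. \<bar>?\<delta> j\<bar>) - lam1 Q * (\<Sum>j\<in>{1..p} - S. \<bar>?\<delta> j\<bar>)"
    using mult_left_mono[OF l1norm_decrease[of \<beta>], of "lam1 Q"] lam_pos by (simp add: right_diff_distrib)
  have "lam2 Q * ((l2norm p b)\<^sup>2 - (l2norm p \<beta>)\<^sup>2) \<le> lam2 Q * (2 * l2norm p b * L2_set ?\<delta> S)"
    using l2norm_decrease lam_pos by (intro mult_left_mono) auto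
  also have "\<dots> = 2 * lam2 Q * l2norm p b * L2_set ?\<delta> S" by simp
  finally have l2: "lam2 Q * ((l2norm p b)\<^sup>2 - (l2norm p \<beta>)\<^sup>2) \<le> ?q" unfolding lam2_eq .
  show ?thesis
    using noise obj S1 l1 l2 unfolding excess_def l1norm_split[of ?\<delta>] by (simp add: algebra_simps)
qed

text \<open>In the cone, \<open>slope\<close> times the eigenvalue is
  \<open>6 * lam1 Q * sqrt (card S)\<close>, so half the middle term bound costs
  \<open>risk_gap \<beta> / 2 + risk_gap b / 2 + m\<close>. This explains \<open>3 / 2\<close> in
  the hypothesis on \<open>R\<close>. Outside the cone, half of the l1-term pays. From
  \<open>8 * lam0 \<le> lam1 Q\<close> the distance comes out as \<open>R / 2\<close>, and this gain
  over \<open>R\<close> is what \<open>oracle_inequality\<close> needs.\<close>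

lemma localized_bound:
  assumes m: "0 \<le> m" "\<And>f. f \<in> F_local Q \<Longrightarrow> slope * dist_f0 f \<le> excess n Q f + m"
    and R: "3 / 2 * risk_gap b + m \<le> lam0 * R"
    and \<beta>: "\<beta> \<in> Phi Q" "lin Q \<beta> \<in> F_local Q"
    and noise: "(risk n Q (lin Q \<beta>) - risk n Q (lin Q b))
      - (emp_risk n Q \<omega> (lin Q \<beta>) - emp_risk n Q \<omega> (lin Q b)) \<le> lam0 * R"
    and obj: "objective \<omega> \<beta> \<le> objective \<omega> b"
  shows "l1norm p (\<lambda>j. \<beta> j - b j) \<le> R / 2" and "risk_gap \<beta> \<le> 4 * (lam0 * R)"
proof -
  let ?\<delta> = "\<lambda>j. \<beta> j - b j"
  define q where "q = lam1 Q * sqrt (card S) * L2_set ?\<delta> S"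
  have l1_nonneg: "0 \<le> l1norm p ?\<delta>" by (simp add: l1norm_def sum_nonneg)
  have gap: "0 \<le> risk_gap \<beta>" "0 \<le> risk_gap b" using excess_nonneg lin_in by auto
  have basic: "risk_gap \<beta> + lam1 Q * l1norm p ?\<delta> \<le> risk_gap b + 3 * q + lam0 * R"
    using basic_inequality[OF noise obj] by (simp add: q_def)
  have main: "risk_gap \<beta> / 2 + lam1 Q * l1norm p ?\<delta> / 2 \<le> 2 * (lam0 * R)"
  proof (cases "(\<Sum>j\<in>{1..p} - S. \<bar>?\<delta> j\<bar>) \<le> 6 * sqrt (card S) * L2_set ?\<delta> S")
    case True
    have "?\<delta> \<in> Rvec p" using \<beta>(1) Phi_sub b_Rvec by (auto simp: Rvec_def subset_iff)
    then have "restr_eig Q b * L2_set ?\<delta> S \<le> Fnorm Q (lin Q ?\<delta>)"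
      using True by (rule restr_eig_le)
    also have "\<dots> \<le> dist_f0 (lin Q \<beta>) + dist_f0 (lin Q b)"
      unfolding lin_diff by (intro Fnorm_diff_triangle lin_in f0_in)
    finally have "slope * (restr_eig Q b * L2_set ?\<delta> S) \<le> slope * (dist_f0 (lin Q \<beta>) + dist_f0 (lin Q b))"
      using slope_pos by (intro mult_left_mono) auto
    moreover have "slope * (restr_eig Q b * L2_set ?\<delta> S) = 6 * q"
      using eig_pos by (simp add: slope_def q_def)
    ultimately have "6 * q \<le> (risk_gap \<beta> + m) + (risk_gap b + m)"
      using m(2)[OF \<beta>(2)] m(2)[OF local_b] by (simp add: distrib_left)
    with basic R l1_nonneg lam_pos gap have "risk_gap \<beta> / 2 + lam1 Q * l1norm p ?\<delta> \<le> 2 * (lam0 * R)"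
      by linarith
    moreover have "0 \<le> lam1 Q * l1norm p ?\<delta>" using l1_nonneg lam_pos by simp
    ultimately show ?thesis by linarith
  next
    case False
    then have "6 * sqrt (card S) * L2_set ?\<delta> S \<le> l1norm p ?\<delta>"
      unfolding l1norm_split by (simp add: add_increasing sum_nonneg)
    then have "6 * q \<le> lam1 Q * l1norm p ?\<delta>"
      unfolding q_def using lam_pos mult_left_mono[of "6 * sqrt (card S) * L2_set ?\<delta> S" "l1norm p ?\<delta>" "lam1 Q"]
      by (simp add: algebra_simps)
    with basic R gap m(1) show ?thesis by linarith
  qed
  have "8 * lam0 * l1norm p ?\<delta> \<le> lam1 Q * l1norm p ?\<delta>"
    using lam1 l1_nonneg by (intro mult_right_mono)
  with main gap have "lam0 * (8 * l1norm p ?\<delta>) \<le> lam0 * (4 * R)" by (simp add: algebra_simps)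
  then show "l1norm p ?\<delta> \<le> R / 2" using pos by simp
  have "0 \<le> lam1 Q * l1norm p ?\<delta>" using l1_nonneg lam_pos by simp
  with main show "risk_gap \<beta> \<le> 4 * (lam0 * R)" by linarith
qed

lemma obs_in: "\<omega> \<in> space (\<Omega>P Q) \<Longrightarrow> i \<in> {1..n} \<Longrightarrow> obs Q i \<omega> \<in> XS Q \<times> YS Q"
proof -
  assume "\<omega> \<in> space (\<Omega>P Q)" "i \<in> {1..n}"
  moreover have "obs Q i \<in> measurable (\<Omega>P Q) (ZM Q)"
    using indep_obs \<open>i \<in> {1..n}\<close> prob_space_\<Omega> by (auto simp: prob_space.indep_vars_def)
  moreover have "space (ZM Q) = XS Q \<times> YS Q"
    by (simp add: ZM_def XS_def space_pair_measure space_restrict_space)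
  ultimately show ?thesis by (auto dest: measurable_space)
qed

lemma objective_convex:
  assumes \<omega>: "\<omega> \<in> space (\<Omega>P Q)" and t: "0 \<le> t" "t \<le> 1"
  shows "objective \<omega> (\<lambda>j. t * \<beta> j + (1 - t) * \<beta>' j) \<le> t * objective \<omega> \<beta> + (1 - t) * objective \<omega> \<beta>'"
proof -
  let ?\<beta> = "\<lambda>j. t * \<beta> j + (1 - t) * \<beta>' j"
  have "emp_risk n Q \<omega> (lin Q ?\<beta>)
      \<le> (\<Sum>i=1..n. t * loss Q (lin Q \<beta>) (obs Q i \<omega>) + (1 - t) * loss Q (lin Q \<beta>') (obs Q i \<omega>)) / n"
    unfolding emp_risk_def lin_convex_comb using obs_in[OF \<omega>] t
    by (intro divide_right_mono sum_mono loss_convex lin_in) auto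
  also have "\<dots> = t * emp_risk n Q \<omega> (lin Q \<beta>) + (1 - t) * emp_risk n Q \<omega> (lin Q \<beta>')"
    by (simp add: emp_risk_def sum.distrib add_divide_distrib flip: sum_distrib_left)
  finally have emp: "emp_risk n Q \<omega> (lin Q ?\<beta>)
      \<le> t * emp_risk n Q \<omega> (lin Q \<beta>) + (1 - t) * emp_risk n Q \<omega> (lin Q \<beta>')" .
  have "l1norm p ?\<beta> \<le> (\<Sum>j=1..p. t * \<bar>\<beta> j\<bar> + (1 - t) * \<bar>\<beta>' j\<bar>)"
    unfolding l1norm_def using t
    by (intro sum_mono) (auto simp: abs_mult intro: abs_triangle_ineq[THEN order_trans])
  then have l1: "lam1 Q * l1norm p ?\<beta> \<le> lam1 Q * (t * l1norm p \<beta> + (1 - t) * l1norm p \<beta>')"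
    using lam_pos by (intro mult_left_mono) (auto simp: l1norm_def sum.distrib sum_distrib_left)
  have sq: "(t * x + (1 - t) * y)\<^sup>2 \<le> t * x\<^sup>2 + (1 - t) * y\<^sup>2" for x y :: real
  proof -
    have "t * x\<^sup>2 + (1 - t) * y\<^sup>2 - (t * x + (1 - t) * y)\<^sup>2 = t * (1 - t) * (x - y)\<^sup>2"
      by (simp add: power2_eq_square algebra_simps)
    moreover have "0 \<le> t * (1 - t) * (x - y)\<^sup>2" using t by simp
    ultimately show ?thesis by linarith
  qed
  have norm_sq: "(l2norm p \<beta>)\<^sup>2 = (\<Sum>j=1..p. (\<beta> j)\<^sup>2)" for \<beta>
    by (simp add: l2norm_def L2_set_def sum_nonneg)
  have "(l2norm p ?\<beta>)\<^sup>2 \<le> (\<Sum>j=1..p. t * (\<beta> j)\<^sup>2 + (1 - t) * (\<beta>' j)\<^sup>2)"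
    unfolding norm_sq by (intro sum_mono sq)
  then have "lam2 Q * (l2norm p ?\<beta>)\<^sup>2 \<le> lam2 Q * (t * (l2norm p \<beta>)\<^sup>2 + (1 - t) * (l2norm p \<beta>')\<^sup>2)"
    using lam_pos by (intro mult_left_mono) (auto simp: norm_sq sum.distrib sum_distrib_left)
  with emp l1 show ?thesis by (simp add: algebra_simps)
qed

text \<open>The localized bound is used twice: first at a point of the segment from \<open>b\<close>
  to the estimator that lies in the ball by construction, which shows that the estimator lies in the
  ball too, and then at the estimator itself.\<close>

lemma oracle_inequality:
  assumes m: "0 \<le> m" "\<And>f. f \<in> F_local Q \<Longrightarrow> slope * dist_f0 f \<le> excess n Q f + m"
    and R: "0 < R" "3 / 2 * risk_gap b + m \<le> lam0 * R"
    and ball: "\<And>\<beta>. \<beta> \<in> Rvec p \<Longrightarrow> l1norm p (\<lambda>j. \<beta> j - b j) \<le> R \<Longrightarrow> lin Q \<beta> \<in> F_local Q"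
    and \<omega>: "\<omega> \<in> space (\<Omega>P Q)"
    and noise: "\<And>\<beta>. \<beta> \<in> Phi Q \<Longrightarrow> l1norm p (\<lambda>j. \<beta> j - b j) \<le> R \<Longrightarrow>
      (risk n Q (lin Q \<beta>) - risk n Q (lin Q b))
      - (emp_risk n Q \<omega> (lin Q \<beta>) - emp_risk n Q \<omega> (lin Q b)) \<le> lam0 * R"
    and est: "is_elastic_net n Q \<omega> \<beta>"
  shows "risk_gap \<beta> \<le> 4 * (lam0 * R)"
proof -
  have \<beta>: "\<beta> \<in> Phi Q" and obj: "objective \<omega> \<beta> \<le> objective \<omega> b"
    using est b_Phi by (auto simp: is_elastic_net_def is_arg_min_def not_less)
  define r where "r = l1norm p (\<lambda>j. \<beta> j - b j)"
  have r: "0 \<le> r" by (simp add: r_def l1norm_def sum_nonneg)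
  define t where "t = R / (R + r)"
  have t: "0 \<le> t" "t \<le> 1" using r R by (auto simp: t_def)
  define \<beta>t where "\<beta>t j = t * \<beta> j + (1 - t) * b j" for j
  have \<beta>t_Phi: "\<beta>t \<in> Phi Q"
    using Phi_convex \<beta> b_Phi t unfolding convex_vecs_def \<beta>t_def[abs_def] by blast
  have "l1norm p (\<lambda>j. \<beta>t j - b j) = (\<Sum>j=1..p. \<bar>t * (\<beta> j - b j)\<bar>)"
    unfolding l1norm_def \<beta>t_def by (simp add: algebra_simps)
  then have norm_t: "l1norm p (\<lambda>j. \<beta>t j - b j) = t * r"
    using t by (simp add: abs_mult r_def l1norm_def sum_distrib_left)
  have "t * r \<le> R" using r R by (simp add: t_def field_simps)
  have "objective \<omega> \<beta>t \<le> t * objective \<omega> \<beta> + (1 - t) * objective \<omega> b"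
    unfolding \<beta>t_def[abs_def] by (rule objective_convex[OF \<omega> t])
  also have "\<dots> \<le> t * objective \<omega> b + (1 - t) * objective \<omega> b"
    using mult_left_mono[OF obj t(1)] by simp
  finally have obj_t: "objective \<omega> \<beta>t \<le> objective \<omega> b" by (simp add: algebra_simps)
  have "lin Q \<beta>t \<in> F_local Q"
    using ball[of \<beta>t] \<beta>t_Phi Phi_sub norm_t \<open>t * r \<le> R\<close> by auto
  then have "t * r \<le> R / 2"
    using localized_bound(1)[OF m R(2) \<beta>t_Phi _ noise[OF \<beta>t_Phi] obj_t] norm_t \<open>t * r \<le> R\<close> by simp
  \<comment> \<open>\<open>R * r / (R + r) \<le> R / 2\<close> says exactly
    \<open>2 * r \<le> R + r\<close>.\<close>
  then have "r \<le> R" using r R by (simp add: t_def field_simps)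
  then show ?thesis
    using localized_bound(2)[OF m R(2) \<beta> _ noise[OF \<beta>] obj] ball[of \<beta>] \<beta> Phi_sub by (auto simp: r_def)
qed

section \<open>The noise event and its probability\<close>

text \<open>The tail bound is applied at level \<open>n * lam0 * R\<close> over a ball of radius
  \<open>R\<close>, so the radius cancels in the exponent. The probability is thus free of the
  unknown excess risk of the oracle.\<close>

lemma noise_event:
  assumes R: "0 < R" and p: "p \<ge> 1"
  obtains A where "A \<in> sets (\<Omega>P Q)"
    "1 - 2 * p * exp (- (n * lam0\<^sup>2 / (32 * (D * K)\<^sup>2))) \<le> measure (\<Omega>P Q) A"
    "\<And>\<omega> \<beta>. \<omega> \<in> A \<Longrightarrow> \<beta> \<in> Phi Q \<Longrightarrow> l1norm p (\<lambda>j. \<beta> j - b j) \<le> R \<Longrightarrow>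
      (risk n Q (lin Q \<beta>) - risk n Q (lin Q b))
      - (emp_risk n Q \<omega> (lin Q \<beta>) - emp_risk n Q \<omega> (lin Q b)) \<le> lam0 * R"
proof -
  interpret prob_space "\<Omega>P Q" by (rule prob_space_\<Omega>)
  define B where "B = {v. (\<lambda>j. v j + b j) \<in> Phi Q \<and> l1norm p v \<le> R}"
  \<comment> \<open>The additive constants \<open>c f\<close> of the loss obey no Lipschitz bound in
    \<open>f\<close>. Subtracting them leaves only \<open>\<gamma>\<close>, and being deterministic
    they cancel between expectation and sample value.\<close>
  define const where "const v = c (lin Q (\<lambda>j. v j + b j)) - c (lin Q b)" for v
  define g where "g v z = loss Q (lin Q (\<lambda>j. v j + b j)) z - loss Q (lin Q b) z - const v" for v z
  define \<psi> where "\<psi> j z = psi Q j (fst z)" for j and z :: "'x \<times> real"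
  have space_ZM: "space (ZM Q) = XS Q \<times> YS Q"
    by (simp add: ZM_def XS_def space_pair_measure space_restrict_space)
  have lin_v: "lin Q (\<lambda>j. v j + b j) (fst z) - lin Q b (fst z) = (\<Sum>j=1..p. v j * \<psi> j z)" for v z
    by (simp add: lin_def \<psi>_def distrib_right sum.distrib)
  have g_eq: "g v z = \<gamma> (snd z) (lin Q (\<lambda>j. v j + b j) (fst z)) - \<gamma> (snd z) (lin Q b (fst z))"
    if "z \<in> space (ZM Q)" for v z
    using that loss_eq[OF lin_in] by (cases z) (auto simp: g_def const_def space_ZM)
  obtain A where A: "A \<in> events"
    "1 - 2 * card {1..p} * exp (- ((n * (lam0 * R))\<^sup>2 / (32 * card {1..n} * (D * R * K)\<^sup>2))) \<le> prob A"
    "\<And>\<omega> v. \<omega> \<in> A \<Longrightarrow> v \<in> B \<Longrightarrow>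
      (\<Sum>i\<in>{1..n}. expectation (\<lambda>\<omega>. g v (obs Q i \<omega>)) - g v (obs Q i \<omega>)) \<le> n * (lam0 * R)"
  proof (rule lipschitz_process_tail[where g = g and \<psi> = \<psi> and B = B and x = "n * (lam0 * R)"
        and K = K and R = R and D = D and J = "{1..p}"])
    show "indep_vars (\<lambda>_. ZM Q) (obs Q) {1..n}" by (rule indep_obs)
    show "g v \<in> borel_measurable (ZM Q)" for v
      unfolding g_def by (intro borel_measurable_diff borel_measurable_const loss_meas lin_in)
    show "\<psi> j \<in> borel_measurable (ZM Q)" if "j \<in> {1..p}" for j
      unfolding \<psi>_def ZM_def using psi_meas[OF that] by measurable
    show "\<bar>\<psi> j z\<bar> \<le> K" if "j \<in> {1..p}" "z \<in> space (ZM Q)" for j z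
      using that by (auto simp: \<psi>_def space_ZM intro: psi_bound)
    show "(\<Sum>j\<in>{1..p}. \<bar>v j\<bar>) \<le> R" if "v \<in> B" for v
      using that by (simp add: B_def l1norm_def)
    show "\<bar>g v z\<bar> \<le> D * \<bar>\<Sum>j\<in>{1..p}. v j * \<psi> j z\<bar>" if "v \<in> B" "z \<in> space (ZM Q)" for v z
      unfolding g_eq[OF that(2)] lin_v[symmetric] using that b_Phi
      by (intro loss_lipschitz) (auto simp: space_ZM B_def)
    show "\<bar>g v z - g v' z\<bar> \<le> D * \<bar>(\<Sum>j\<in>{1..p}. v j * \<psi> j z) - (\<Sum>j\<in>{1..p}. v' j * \<psi> j z)\<bar>"
      if "v \<in> B" "v' \<in> B" "z \<in> space (ZM Q)" for v v' z
      unfolding g_eq[OF that(3)] lin_v[symmetric]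
      using loss_lipschitz[of "fst z" "snd z" "\<lambda>j. v j + b j" "\<lambda>j. v' j + b j"] that
      by (auto simp: space_ZM B_def)
    show "0 < D" "0 < K" "0 < R" "0 < n * (lam0 * R)" using pos R n by auto
  qed (use n p in auto)
  show ?thesis
  proof (rule that[OF A(1)])
    have "(n * (lam0 * R))\<^sup>2 / (32 * n * (D * R * K)\<^sup>2) = n * lam0\<^sup>2 / (32 * (D * K)\<^sup>2)"
      using R n pos by (simp add: power2_eq_square field_simps)
    then show "1 - 2 * p * exp (- (n * lam0\<^sup>2 / (32 * (D * K)\<^sup>2))) \<le> measure (\<Omega>P Q) A"
      using A(2) by simp
    fix \<omega> \<beta> assume \<omega>: "\<omega> \<in> A" and \<beta>: "\<beta> \<in> Phi Q" "l1norm p (\<lambda>j. \<beta> j - b j) \<le> R"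
    define v where "v j = \<beta> j - b j" for j
    have vb: "(\<lambda>j. v j + b j) = \<beta>" by (simp add: v_def)
    have "v \<in> B" using \<beta> unfolding B_def vb v_def[abs_def] by simp
    have "expectation (\<lambda>\<omega>. g v (obs Q i \<omega>)) - g v (obs Q i \<omega>)
        = (expectation (\<lambda>\<omega>. loss Q (lin Q \<beta>) (obs Q i \<omega>)) - expectation (\<lambda>\<omega>. loss Q (lin Q b) (obs Q i \<omega>)))
          - (loss Q (lin Q \<beta>) (obs Q i \<omega>) - loss Q (lin Q b) (obs Q i \<omega>))"
      if "i \<in> {1..n}" for i
      unfolding g_def vb using loss_integrable[OF lin_in that] by (simp add: prob_space)
    then have "(\<Sum>i\<in>{1..n}. expectation (\<lambda>\<omega>. g v (obs Q i \<omega>)) - g v (obs Q i \<omega>))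
        = n * ((risk n Q (lin Q \<beta>) - risk n Q (lin Q b)) - (emp_risk n Q \<omega> (lin Q \<beta>) - emp_risk n Q \<omega> (lin Q b)))"
      using n by (simp add: risk_def emp_risk_def sum_subtractf right_diff_distrib)
    with A(3)[OF \<omega> \<open>v \<in> B\<close>] n show "(risk n Q (lin Q \<beta>) - risk n Q (lin Q b))
      - (emp_risk n Q \<omega> (lin Q \<beta>) - emp_risk n Q \<omega> (lin Q b)) \<le> lam0 * R"
      by simp
  qed
qed

text \<open>\<open>G\<close> may be negative, so \<open>conj_slope\<close> need not vanish as \<open>slope\<close> does. The
  hypothesis on \<open>\<sigma>\<close> and \<open>C\<close>, which is the Fenchel inequality at one fixed larger slope,
  supplies the bound by \<open>e\<close>.\<close>
lemma slope_dist_le: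
  assumes \<sigma>: "0 < \<sigma>" "slope \<le> \<sigma>" and C: "slope * C \<le> e * \<sigma>"
    and G: "\<And>u. 0 \<le> u \<Longrightarrow> \<sigma> * u \<le> G u + C" and f: "f \<in> F_local Q"
  shows "slope * dist_f0 f \<le> excess n Q f + min conj_slope e"
proof -
  have f_in: "f \<in> Fsp Q" using f by (simp add: F_local_def)
  have u: "0 \<le> dist_f0 f" using f_in f0_in by (intro Fnorm_nonneg Fsp_diff)
  have "slope * dist_f0 f \<le> excess n Q f + conj_slope"
    using fenchel[OF u] margin[OF f] by linarith
  moreover have "slope * dist_f0 f \<le> excess n Q f + e"
  proof -
    \<comment> \<open>The inequality at slope \<open>\<sigma>\<close> is scaled by
      \<open>slope / \<sigma> \<le> 1\<close>. The excess risk may then be restored to full size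
      because it is nonnegative.\<close>
    have "slope * (\<sigma> * dist_f0 f) \<le> slope * (excess n Q f + C)"
      using slope_pos G[OF u] margin[OF f] by (intro mult_left_mono) auto
    also have "\<dots> \<le> \<sigma> * excess n Q f + e * \<sigma>"
      using \<sigma> C excess_nonneg[OF f_in] by (simp add: distrib_left add_mono mult_right_mono)
    finally have "\<sigma> * (slope * dist_f0 f) \<le> \<sigma> * (excess n Q f + e)" by (simp add: algebra_simps)
    then show ?thesis using \<sigma> by simp
  qed
  ultimately show ?thesis by simp
qed

text \<open>The factor 6 is \<open>4 * (3 / 2)\<close>: the oracle inequality gives
  \<open>4 * (lam0 * R)\<close>, and \<open>local_radius\<close> caps \<open>lam0 * R\<close> by
  \<open>3 / 2 * risk_gap b + e\<close>.\<close>

lemma excess_bound_event: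
  assumes e: "0 < e" and p: "p \<ge> 1"
    and \<sigma>: "0 < \<sigma>" "slope \<le> \<sigma>" "slope * C \<le> e * \<sigma>" "\<And>u. 0 \<le> u \<Longrightarrow> \<sigma> * u \<le> G u + C"
    and est: "\<And>\<omega>. \<omega> \<in> space (\<Omega>P Q) \<Longrightarrow> is_elastic_net n Q \<omega> (bhat \<omega>)"
  obtains A where "A \<in> sets (\<Omega>P Q)"
    "1 - 2 * p * exp (- (n * lam0\<^sup>2 / (32 * (D * K)\<^sup>2))) \<le> measure (\<Omega>P Q) A"
    "\<And>\<omega>. \<omega> \<in> A \<Longrightarrow> risk_gap (bhat \<omega>) \<le> 6 * risk_gap b + 4 * e"
proof -
  obtain R where R: "0 < R" "3 / 2 * risk_gap b + min conj_slope e \<le> lam0 * R"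
      "lam0 * R \<le> 3 / 2 * risk_gap b + e"
      "\<And>\<beta>. \<beta> \<in> Rvec p \<Longrightarrow> l1norm p (\<lambda>j. \<beta> j - b j) \<le> R \<Longrightarrow> lin Q \<beta> \<in> F_local Q"
    using local_radius[OF e] by blast
  obtain A where A: "A \<in> sets (\<Omega>P Q)"
    "1 - 2 * p * exp (- (n * lam0\<^sup>2 / (32 * (D * K)\<^sup>2))) \<le> measure (\<Omega>P Q) A"
    "\<And>\<omega> \<beta>. \<omega> \<in> A \<Longrightarrow> \<beta> \<in> Phi Q \<Longrightarrow> l1norm p (\<lambda>j. \<beta> j - b j) \<le> R \<Longrightarrow>
      (risk n Q (lin Q \<beta>) - risk n Q (lin Q b))
      - (emp_risk n Q \<omega> (lin Q \<beta>) - emp_risk n Q \<omega> (lin Q b)) \<le> lam0 * R"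
    using noise_event[OF R(1) p] by blast
  show ?thesis
  proof (rule that[OF A(1,2)])
    fix \<omega> assume \<omega>: "\<omega> \<in> A"
    then have sp: "\<omega> \<in> space (\<Omega>P Q)" using sets.sets_into_space[OF A(1)] by blast
    have "risk_gap (bhat \<omega>) \<le> 4 * (lam0 * R)"
      by (rule oracle_inequality[OF _ slope_dist_le[OF \<sigma>] R(1,2,4) sp A(3)[OF \<omega>] est[OF sp]])
        (use e conj_slope_nonneg in auto)
    with R(3) show "risk_gap (bhat \<omega>) \<le> 6 * risk_gap b + 4 * e" by linarith
  qed
qed

end

section \<open>Consistency\<close>

lemma inner_prob_le_1: "prob_space M \<Longrightarrow> inner_prob M A \<le> 1"
  unfolding inner_prob_def by (rule cSup_least) (auto simp: prob_space.prob_le_1)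

lemma measure_le_inner_prob:
  assumes "prob_space M" "B \<in> sets M" "B \<subseteq> A"
  shows "measure M B \<le> inner_prob M A"
  unfolding inner_prob_def using assms
  by (intro cSup_upper bdd_aboveI[where M = 1]) (auto simp: prob_space.prob_le_1)

text \<open>The target event involves an estimator without measurability assumptions; a measurable
  subset of large probability suffices for inner probability.\<close>

lemma tendsto_inner_prob_1:
  assumes M: "\<And>n. n \<ge> 1 \<Longrightarrow> prob_space (M n)" and r: "r \<longlonglongrightarrow> (0 :: real)"
    and ev: "\<forall>\<^sub>F n in sequentially. \<exists>B\<in>sets (M n). B \<subseteq> A n \<and> 1 - r n \<le> measure (M n) B"
  shows "(\<lambda>n. inner_prob (M n) (A n)) \<longlonglongrightarrow> 1"
proof (rule tendsto_sandwich)
  show "\<forall>\<^sub>F n in sequentially. 1 - r n \<le> inner_prob (M n) (A n)"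
    using ev eventually_ge_at_top[of 1]
    by eventually_elim (use M measure_le_inner_prob in \<open>blast intro: order_trans\<close>)
  show "\<forall>\<^sub>F n in sequentially. inner_prob (M n) (A n) \<le> 1"
    using eventually_ge_at_top[of 1] by eventually_elim (use M inner_prob_le_1 in blast)
  show "(\<lambda>n. 1 - r n) \<longlonglongrightarrow> 1" using tendsto_diff[OF tendsto_const r, of 1] by simp
qed simp

lemma tendsto_log_dim_times_sparsity:
  fixes p s :: "nat \<Rightarrow> nat" and a b :: real
  assumes p: "(\<lambda>n. real (p n)) \<in> O(\<lambda>n. exp (real n powr a))" "\<And>n. n \<ge> 1 \<Longrightarrow> p n \<ge> 2"
    and s: "(\<lambda>n. real (s n)) \<in> O(\<lambda>n. real n powr b)"
    and ab: "a > 0" "a + b < 1"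
  shows "(\<lambda>n. ln (real (p n)) * real (s n) / real n) \<longlonglongrightarrow> 0"
proof -
  obtain C where C: "C > 0" "\<forall>\<^sub>F n in sequentially. norm (real (p n)) \<le> C * norm (exp (real n powr a))"
    using p(1) by (rule landau_o.bigE)
  obtain C' where C': "C' > 0" "\<forall>\<^sub>F n in sequentially. norm (real (s n)) \<le> C' * norm (real n powr b)"
    using s by (rule landau_o.bigE)
  define c where "c = (\<bar>ln C\<bar> + 1) * C'"
  have ub: "\<forall>\<^sub>F n in sequentially. ln (real (p n)) * real (s n) / real n \<le> c * real n powr (a + b - 1)"
    using C(2) C'(2) eventually_ge_at_top[of 1]
  proof eventually_elim
    case (elim n)
    have p2: "p n \<ge> 2" using p(2) elim by simp
    have na: "1 \<le> real n powr a" using elim ab by (simp add: ge_one_powr_ge_zero)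
    have "ln (real (p n)) \<le> ln (C * exp (real n powr a))"
      using elim p2 by (intro ln_mono) auto
    also have "\<dots> = ln C + real n powr a" using C by (simp add: ln_mult)
    \<comment> \<open>As \<open>n powr a\<close> is at least 1, it absorbs the additive constant
      \<open>ln C\<close>.\<close>
    also have "\<dots> \<le> \<bar>ln C\<bar> * real n powr a + real n powr a"
      using mult_left_mono[OF na, of "\<bar>ln C\<bar>"] by simp
    finally have lnp: "ln (real (p n)) \<le> (\<bar>ln C\<bar> + 1) * real n powr a" by (simp add: algebra_simps)
    have "ln (real (p n)) * real (s n) \<le> ((\<bar>ln C\<bar> + 1) * real n powr a) * (C' * real n powr b)"
      using elim p2 lnp by (intro mult_mono) auto
    then have "ln (real (p n)) * real (s n) / real n
        \<le> ((\<bar>ln C\<bar> + 1) * real n powr a) * (C' * real n powr b) / real n"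
      by (rule divide_right_mono) simp
    also have "\<dots> = c * real n powr (a + b - 1)"
      using elim by (simp add: c_def powr_add powr_diff)
    finally show ?case .
  qed
  have lim: "(\<lambda>n. c * real n powr (a + b - 1)) \<longlonglongrightarrow> 0"
    using ab by (intro tendsto_mult_right_zero tendsto_neg_powr filterlim_real_sequentially) simp
  have lb: "\<forall>\<^sub>F n in sequentially. 0 \<le> ln (real (p n)) * real (s n) / real n"
    using eventually_ge_at_top[of 1]
  proof eventually_elim
    case (elim n)
    then have "p n \<ge> 2" using p(2) by simp
    then show ?case by simp
  qed
  show ?thesis by (rule tendsto_sandwich[OF lb ub tendsto_const lim])
qed

theorem corollary1:
  fixes G :: "real \<Rightarrow> real" and K D L a b :: real
  assumes "strictly_convex_on {0..} G" and "G 0 = 0"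
    and "K > 0" and "D > 0" and "L \<ge> 8"
    and "a > 0" and "b \<ge> 0" and "a + b < 1"
  shows "\<exists>d>0. \<forall>(Q :: nat \<Rightarrow> ('w, 'x) problem) \<gamma> c (bstar :: nat \<Rightarrow> nat \<Rightarrow> real)
      (bhat :: nat \<Rightarrow> 'w \<Rightarrow> nat \<Rightarrow> real) (lam0 :: nat \<Rightarrow> real).
    (\<forall>n\<ge>1. setting n (Q n)) \<longrightarrow>
    (\<forall>n\<ge>1. \<forall>\<omega>\<in>space (\<Omega>P (Q n)). is_elastic_net n (Q n) \<omega> (bhat n \<omega>)) \<longrightarrow>
    (\<forall>n\<ge>1. is_oracle n G (Q n) (bstar n) \<and> bstar n \<in> Phi (Q n)) \<longrightarrow>
    filterlim (\<lambda>n. dimp (Q n)) at_top sequentially \<longrightarrow>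
    (\<lambda>n. real (dimp (Q n))) \<in> O(\<lambda>n. exp (real n powr a)) \<longrightarrow>
    (\<lambda>n. real (card (supp (dimp (Q n)) (bstar n)))) \<in> O(\<lambda>n. real n powr b) \<longrightarrow>
    (\<forall>n\<ge>1. \<forall>f\<in>Fsp (Q n). \<forall>x\<in>XS (Q n). \<forall>y\<in>YS (Q n).
        loss (Q n) f (x, y) = \<gamma> n y (f x) + c n f) \<longrightarrow>
    (\<forall>n\<ge>1. \<forall>x\<in>XS (Q n). \<forall>y\<in>YS (Q n). \<forall>\<beta>\<in>Phi (Q n). \<forall>\<beta>'\<in>Phi (Q n).
        \<bar>\<gamma> n y (lin (Q n) \<beta> x) - \<gamma> n y (lin (Q n) \<beta>' x)\<bar>
          \<le> D * \<bar>lin (Q n) \<beta> x - lin (Q n) \<beta>' x\<bar>) \<longrightarrow>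
    (\<forall>n\<ge>1. (\<Sum>i=1..n. MAX j\<in>{1..dimp (Q n)}.
        (\<integral>\<omega>. (psi (Q n) j (fst (obs (Q n) i \<omega>)))\<^sup>2 \<partial>\<Omega>P (Q n))) / real n \<le> 1) \<longrightarrow>
    (\<forall>n\<ge>1. (MAX j\<in>{1..dimp (Q n)}. supnorm_on (XS (Q n)) (psi (Q n) j)) \<le> ereal K) \<longrightarrow>
    (\<forall>n\<ge>1. dimp (Q n) \<ge> 2 \<and> ln (real (dimp (Q n))) \<le> real n) \<longrightarrow>
    (\<forall>n\<ge>1. lam0 n = d * D * sqrt (ln (real (dimp (Q n))) / real n)) \<longrightarrow>
    (\<forall>n\<ge>1. 8 * lam0 n \<le> lam1 (Q n) \<and> lam1 (Q n) \<le> L * lam0 n) \<longrightarrow>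
    (\<forall>n\<ge>1. lam2 (Q n) = lam1 (Q n) * sqrt (real (card (supp (dimp (Q n)) (bstar n))))
                          / (2 * l2norm (dimp (Q n)) (bstar n))) \<longrightarrow>
    (\<forall>n\<ge>1. \<forall>f\<in>F_local (Q n).
        excess n (Q n) f \<ge> G (Fnorm (Q n) (\<lambda>x. f x - target (Q n) x))) \<longrightarrow>
    (\<forall>n\<ge>1. lin (Q n) (bstar n) \<in> F_local (Q n) \<and>
        (\<forall>\<beta>\<in>Rvec (dimp (Q n)).
           ereal (l1norm (dimp (Q n)) (\<lambda>j. \<beta> j - bstar n j)) \<le> M_star n G (Q n) (bstar n) (lam0 n)
           \<longrightarrow> lin (Q n) \<beta> \<in> F_local (Q n))) \<longrightarrow>
    (\<forall>n\<ge>1. restr_eig (Q n) (bstar n) > 0) \<longrightarrow>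
    (\<exists>\<phi>0>0. \<forall>n\<ge>1. restr_eig (Q n) (bstar n) \<ge> \<phi>0) \<longrightarrow>
    (\<forall>\<epsilon>>0. (\<lambda>n. inner_prob (\<Omega>P (Q n))
        {\<omega> \<in> space (\<Omega>P (Q n)).
           ereal (excess n (Q n) (lin (Q n) (bhat n \<omega>)))
             \<le> 6 * limsup (\<lambda>m. ereal (excess m (Q m) (lin (Q m) (bstar m)))) + ereal \<epsilon>})
      \<longlonglongrightarrow> 1)"
proof (intro exI[of _ "8 * K"] conjI allI impI)
  show "0 < 8 * K" using \<open>K > 0\<close> by simp
next
  fix Q :: "nat \<Rightarrow> ('w, 'x) problem" and \<gamma> c and bstar :: "nat \<Rightarrow> nat \<Rightarrow> real"
    and bhat :: "nat \<Rightarrow> 'w \<Rightarrow> nat \<Rightarrow> real" and lam0 :: "nat \<Rightarrow> real" and \<epsilon> :: real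
  let ?s = "\<lambda>n. card (supp (dimp (Q n)) (bstar n))"
  let ?gap = "\<lambda>n. excess n (Q n) (lin (Q n) (bstar n))"
  assume setting: "\<forall>n\<ge>1. setting n (Q n)"
    and est: "\<forall>n\<ge>1. \<forall>\<omega>\<in>space (\<Omega>P (Q n)). is_elastic_net n (Q n) \<omega> (bhat n \<omega>)"
    and bstar_oracle: "\<forall>n\<ge>1. is_oracle n G (Q n) (bstar n) \<and> bstar n \<in> Phi (Q n)"
    and p_lim: "filterlim (\<lambda>n. dimp (Q n)) at_top sequentially"
    and p_growth: "(\<lambda>n. real (dimp (Q n))) \<in> O(\<lambda>n. exp (real n powr a))"
    and s_growth: "(\<lambda>n. real (?s n)) \<in> O(\<lambda>n. real n powr b)"
    and loss: "\<forall>n\<ge>1. \<forall>f\<in>Fsp (Q n). \<forall>x\<in>XS (Q n). \<forall>y\<in>YS (Q n). loss (Q n) f (x, y) = \<gamma> n y (f x) + c n f"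
    and lip: "\<forall>n\<ge>1. \<forall>x\<in>XS (Q n). \<forall>y\<in>YS (Q n). \<forall>\<beta>\<in>Phi (Q n). \<forall>\<beta>'\<in>Phi (Q n).
        \<bar>\<gamma> n y (lin (Q n) \<beta> x) - \<gamma> n y (lin (Q n) \<beta>' x)\<bar> \<le> D * \<bar>lin (Q n) \<beta> x - lin (Q n) \<beta>' x\<bar>"
    and psi_sup: "\<forall>n\<ge>1. (MAX j\<in>{1..dimp (Q n)}. supnorm_on (XS (Q n)) (psi (Q n) j)) \<le> ereal K"
    and p2: "\<forall>n\<ge>1. dimp (Q n) \<ge> 2 \<and> ln (real (dimp (Q n))) \<le> real n"
    and lam0: "\<forall>n\<ge>1. lam0 n = 8 * K * D * sqrt (ln (real (dimp (Q n))) / real n)"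
    and lam1_bounds: "\<forall>n\<ge>1. 8 * lam0 n \<le> lam1 (Q n) \<and> lam1 (Q n) \<le> L * lam0 n"
    and lam2: "\<forall>n\<ge>1. lam2 (Q n) = lam1 (Q n) * sqrt (real (?s n)) / (2 * l2norm (dimp (Q n)) (bstar n))"
    and margin: "\<forall>n\<ge>1. \<forall>f\<in>F_local (Q n). excess n (Q n) f \<ge> G (Fnorm (Q n) (\<lambda>x. f x - target (Q n) x))"
    and locality: "\<forall>n\<ge>1. lin (Q n) (bstar n) \<in> F_local (Q n) \<and>
        (\<forall>\<beta>\<in>Rvec (dimp (Q n)).
           ereal (l1norm (dimp (Q n)) (\<lambda>j. \<beta> j - bstar n j)) \<le> M_star n G (Q n) (bstar n) (lam0 n)
           \<longrightarrow> lin (Q n) \<beta> \<in> F_local (Q n))"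
    and eig: "\<forall>n\<ge>1. restr_eig (Q n) (bstar n) > 0"
    and eig_bounded: "\<exists>\<phi>0>0. \<forall>n\<ge>1. restr_eig (Q n) (bstar n) \<ge> \<phi>0"
    and \<epsilon>: "\<epsilon> > 0"
  obtain \<phi>0 where \<phi>0: "\<phi>0 > 0" "\<And>n. n \<ge> 1 \<Longrightarrow> restr_eig (Q n) (bstar n) \<ge> \<phi>0"
    using eig_bounded by blast
  have ln_pos: "0 < ln (real (dimp (Q n)))" if "n \<ge> 1" for n
    using p2[rule_format, OF that] by simp
  have psi_bound: "\<bar>psi (Q n) j x\<bar> \<le> K" if "n \<ge> 1" "j \<in> {1..dimp (Q n)}" "x \<in> XS (Q n)" for n j x
  proof -
    have "ereal \<bar>psi (Q n) j x\<bar> \<le> supnorm_on (XS (Q n)) (psi (Q n) j)"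
      unfolding supnorm_on_def using that by (intro SUP_upper)
    also have "\<dots> \<le> (MAX j\<in>{1..dimp (Q n)}. supnorm_on (XS (Q n)) (psi (Q n) j))"
      using that by (intro Max_ge) auto
    also have "\<dots> \<le> ereal K" using psi_sup that by blast
    finally show ?thesis by simp
  qed
  have oset: "oracle_setting n (Q n) G (bstar n) K D (lam0 n) (\<gamma> n) (c n)" if n: "n \<ge> 1" for n
  proof
    show "0 < lam0 n" using lam0 ln_pos[OF n] n \<open>K > 0\<close> \<open>D > 0\<close> by simp
    show "\<bar>psi (Q n) j x\<bar> \<le> K" if "j \<in> {1..dimp (Q n)}" "x \<in> XS (Q n)" for j x
      using psi_bound n that by blast
  qed (use n assms setting bstar_oracle loss lip lam1_bounds lam2 margin locality eig in blast)+
  define v where "v n = 6 * lam1 (Q n) * sqrt (?s n) / restr_eig (Q n) (bstar n)" for n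
  have slope: "oracle_setting.slope (Q n) (bstar n) = v n" if "n \<ge> 1" for n
    unfolding v_def by (rule oracle_setting.slope_def[OF oset[OF that]])
  define h where "h n = sqrt (ln (real (dimp (Q n))) * real (?s n) / real n)" for n
  have v_lim: "v \<longlonglongrightarrow> 0"
  proof (rule tendsto_sandwich[where f = "\<lambda>_. 0" and h = "\<lambda>n. 6 * L * (8 * K * D) / \<phi>0 * h n"])
    have "(\<lambda>n. ln (real (dimp (Q n))) * real (?s n) / real n) \<longlonglongrightarrow> 0"
      using p2 assms by (intro tendsto_log_dim_times_sparsity[OF p_growth _ s_growth]) auto
    then have "h \<longlonglongrightarrow> 0" unfolding h_def using tendsto_real_sqrt by fastforce
    then show "(\<lambda>n. 6 * L * (8 * K * D) / \<phi>0 * h n) \<longlonglongrightarrow> 0"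
      by (rule tendsto_mult_right_zero)
    show "\<forall>\<^sub>F n in sequentially. 0 \<le> v n"
      using eventually_ge_at_top[of 1]
      by eventually_elim (use slope oracle_setting.slope_pos[OF oset] in \<open>auto intro: less_imp_le\<close>)
    show "\<forall>\<^sub>F n in sequentially. v n \<le> 6 * L * (8 * K * D) / \<phi>0 * h n"
      using eventually_ge_at_top[of 1]
    proof eventually_elim
      case (elim n)
      interpret oracle_setting n "Q n" G "bstar n" K D "lam0 n" "\<gamma> n" "c n" by (rule oset[OF elim])
      have "6 * lam1 (Q n) * sqrt (?s n) \<le> 6 * (L * lam0 n) * sqrt (?s n)"
        using lam1_bounds elim by (intro mult_right_mono) auto
      then have "v n \<le> 6 * (L * lam0 n) * sqrt (?s n) / \<phi>0"
        unfolding v_def using \<phi>0 elim pos \<open>L \<ge> 8\<close> by (intro frac_le) auto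
      also have "\<dots> = 6 * L * (8 * K * D) / \<phi>0 * h n"
        using lam0 elim by (simp add: h_def real_sqrt_mult real_sqrt_divide mult_ac)
      finally show ?case .
    qed
  qed simp
  \<comment> \<open>\<open>G\<close> is the same for all \<open>n\<close>, so the first problem
    supplies one fixed slope at which its conjugate is known to be finite. All later slopes are
    eventually compared with it.\<close>
  interpret first: oracle_setting 1 "Q 1" G "bstar 1" K D "lam0 1" "\<gamma> 1" "c 1" by (rule oset) simp
  define \<sigma> C e where "\<sigma> = first.slope" and "C = first.conj_slope" and "e = \<epsilon> / 8"
  have \<sigma>: "0 < \<sigma>" and G_ge: "\<And>u. 0 \<le> u \<Longrightarrow> \<sigma> * u \<le> G u + C" and e: "0 < e"
    unfolding \<sigma>_def C_def e_def using first.slope_pos first.fenchel \<epsilon> by auto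
  have "\<forall>\<^sub>F n in sequentially. v n < \<sigma>"
    using v_lim \<sigma> by (rule order_tendstoD)
  moreover have "\<forall>\<^sub>F n in sequentially. v n * C < e * \<sigma>"
    using tendsto_mult_left_zero[OF v_lim, of C] by (rule order_tendstoD) (use e \<sigma> in simp)
  moreover have "\<forall>\<^sub>F n in sequentially. ereal (6 * ?gap n + 4 * e) \<le> 6 * limsup (\<lambda>m. ereal (?gap m)) + ereal \<epsilon>"
  proof -
    \<comment> \<open>Nonnegativity rules out a limit superior of minus infinity; at plus infinity
      the claim is trivial.\<close>
    have "0 \<le> limsup (\<lambda>m. ereal (?gap m))"
    proof (rule le_Limsup)
      show "\<forall>\<^sub>F m in sequentially. 0 \<le> ereal (?gap m)"
        using eventually_ge_at_top[of 1]
      proof eventually_elim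
        case (elim m)
        interpret oracle_setting m "Q m" G "bstar m" K D "lam0 m" "\<gamma> m" "c m" by (rule oset[OF elim])
        show ?case using excess_nonneg[OF lin_in] by simp
      qed
    qed simp
    then consider r where "limsup (\<lambda>m. ereal (?gap m)) = ereal r" | "limsup (\<lambda>m. ereal (?gap m)) = \<infinity>"
      by (cases "limsup (\<lambda>m. ereal (?gap m))") auto
    then show ?thesis
    proof cases
      case 1
      \<comment> \<open>The slack is split evenly: \<open>6 * (\<epsilon> / 12)\<close> here and
        \<open>4 * e\<close> with \<open>e = \<epsilon> / 8\<close> each give
        \<open>\<epsilon> / 2\<close>.\<close>
      then have "limsup (\<lambda>m. ereal (?gap m)) < ereal (r + \<epsilon> / 12)" using \<epsilon> by simp
      then have "\<forall>\<^sub>F m in sequentially. ereal (?gap m) < ereal (r + \<epsilon> / 12)" by (rule Limsup_lessD)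
      then show ?thesis
        by eventually_elim (simp add: 1 e_def)
    next
      case 2
      then show ?thesis by simp
    qed
  qed
  ultimately have "\<forall>\<^sub>F n in sequentially. \<exists>B\<in>sets (\<Omega>P (Q n)).
      B \<subseteq> {\<omega> \<in> space (\<Omega>P (Q n)). ereal (excess n (Q n) (lin (Q n) (bhat n \<omega>)))
             \<le> 6 * limsup (\<lambda>m. ereal (?gap m)) + ereal \<epsilon>}
      \<and> 1 - 2 / real (dimp (Q n)) \<le> measure (\<Omega>P (Q n)) B"
    using eventually_ge_at_top[of 1]
  proof eventually_elim
    case (elim n)
    interpret oracle_setting n "Q n" G "bstar n" K D "lam0 n" "\<gamma> n" "c n" by (rule oset) fact
    have p: "dimp (Q n) \<ge> 2" using p2 elim by blast
    obtain A where A: "A \<in> sets (\<Omega>P (Q n))"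
      "1 - 2 * dimp (Q n) * exp (- (n * (lam0 n)\<^sup>2 / (32 * (D * K)\<^sup>2))) \<le> measure (\<Omega>P (Q n)) A"
      "\<And>\<omega>. \<omega> \<in> A \<Longrightarrow> excess n (Q n) (lin (Q n) (bhat n \<omega>)) \<le> 6 * ?gap n + 4 * e"
      using excess_bound_event[OF e _ \<sigma> _ _ G_ge, of "bhat n"] elim p est slope[OF \<open>1 \<le> n\<close>] by auto
    \<comment> \<open>With \<open>lam0\<close> built from \<open>8 * K * D\<close> the constants
      leave \<open>64 / 32 = 2\<close>, so the exponential is the inverse square of the dimension
      and beats the factor \<open>2 * dimp (Q n)\<close> in front.\<close>
    have "n * (lam0 n)\<^sup>2 / (32 * (D * K)\<^sup>2) = 2 * ln (dimp (Q n))"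
      using lam0 elim ln_pos[OF \<open>1 \<le> n\<close>] assms by (simp add: power_mult_distrib)
    then have "exp (- (n * (lam0 n)\<^sup>2 / (32 * (D * K)\<^sup>2))) = 1 / (real (dimp (Q n)))\<^sup>2"
      using p by (simp add: exp_minus exp_of_nat_mult[of 2, simplified] inverse_eq_divide)
    then have "1 - 2 / real (dimp (Q n)) \<le> measure (\<Omega>P (Q n)) A"
      using A(2) p by (simp add: power2_eq_square)
    moreover have "A \<subseteq> {\<omega> \<in> space (\<Omega>P (Q n)). ereal (excess n (Q n) (lin (Q n) (bhat n \<omega>)))
             \<le> 6 * limsup (\<lambda>m. ereal (?gap m)) + ereal \<epsilon>}"
      using sets.sets_into_space[OF A(1)] A(3) elim(3)
      by (auto intro: order_trans[of _ "ereal (6 * ?gap n + 4 * e)"])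
    ultimately show ?case using A(1) by blast
  qed
  moreover have "(\<lambda>n. 2 / real (dimp (Q n))) \<longlonglongrightarrow> 0"
    using filterlim_compose[OF filterlim_real_sequentially p_lim]
    by (intro tendsto_divide_0[OF tendsto_const] filterlim_at_top_imp_at_infinity)
  moreover have "prob_space (\<Omega>P (Q n))" if "n \<ge> 1" for n
    using setting that by (simp add: setting_def)
  ultimately show "(\<lambda>n. inner_prob (\<Omega>P (Q n))
        {\<omega> \<in> space (\<Omega>P (Q n)).
           ereal (excess n (Q n) (lin (Q n) (bhat n \<omega>)))
             \<le> 6 * limsup (\<lambda>m. ereal (?gap m)) + ereal \<epsilon>})
      \<longlonglongrightarrow> 1"
    by (intro tendsto_inner_prob_1[where r = "\<lambda>n. 2 / real (dimp (Q n))"])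
qed

end
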